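(* Let $P_X$ be a discrete memoryless source with finite alphabet $\mathcal{X}$ and let $E_0>0$. Necessary and sufficient conditions for the existence of variable-rate codes, with secret-key rate function $R_{\mathrm{s}}(\cdot)$ and helper-message rate function $R_{\mathrm{w}}(\cdot)$, that achieve a false-accept (FA) error exponent at least as large as $E_0$ are that, for every probability distribution $Q_X$ on $\mathcal{X}$, $$R_{\mathrm{s}}(Q_X)\ge R_{\mathrm{s}}^*(Q_X,E_0),\qquad R_{\mathrm{w}}(Q_X)\le R_{\mathrm{w}}^*(Q_X,E_0),$$ where $$R_{\mathrm{s}}^*(Q_X,E_0)=E_0-D(Q_X\|P_X)$$ and $$R_{\mathrm{w}}^*(Q_X,E_0)=\begin{cases}\mathbf{E}_Q\log\frac{1}{P_X(X)}-E_0 & \text{if } D(Q_X\|P_X)<E_0,\\ \infty & \text{if } D(Q_X\|P_X)\ge E_0.\end{cases}$$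
   Context: Logarithms are natural. $D(Q_X\|P_X)$ is the Kullback--Leibler divergence and $\mathbf{E}_Q\log\frac{1}{P_X(X)}=\sum_{x\in\mathcal{X}}Q_X(x)\log\frac{1}{P_X(x)}$. Setting (biometric authentication by secret key generation): a random vector $\mathbf{X}=(X_1,\ldots,X_n)$ is drawn i.i.d. from $P_X$. The type of a vector $\mathbf{x}\in\mathcal{X}^n$ is its empirical distribution. Rate functions $R_{\mathrm{s}}(\cdot)$ and $R_{\mathrm{w}}(\cdot)$ are given continuous functions of a distribution $Q_X$ on $\mathcal{X}$. A variable-rate code with these rate functions is an enrollment encoder that maps each $\mathbf{x}\in\mathcal{X}^n$ of type $Q_X$ to a secret key $\mathbf{s}=g(\mathbf{x})$ in a set of (exponential) size $e^{nR_{\mathrm{s}}(Q_X)}$, consisting of consecutive integer indices, and to a helper message $\mathbf{w}=f(\mathbf{x})$ in a set of (exponential) size $e^{nR_{\mathrm{w}}(Q_X)}$, likewise consisting of consecutive integer indices. The codes considered are generated by random binning: for each $\mathbf{x}$ of type $Q_X$, $g(\mathbf{x})$ and $f(\mathbf{x})$ are selected independently at random, uniformly over the respective sets. The helper message is public. Write $\mathbf{S}=g(\mathbf{X})$ and $\mathbf{W}=f(\mathbf{X})$. An imposter, who knows the code and sees only the helper message, estimates the secret key by $V(\mathbf{w})=\arg\max_{\mathbf{s}}\Pr\{\mathbf{S}=\mathbf{s}\mid\mathbf{W}=\mathbf{w}\}$ (and then forges biometric data that makes the authentication decoder output this estimate). The FA probability is the probability $\Pr\{V(\mathbf{W})=\mathbf{S}\}$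 that this succeeds, and the FA error exponent is the exponential rate of decay of the FA probability as $n\to\infty$. *)

theory Defs
  imports "HOL-Probability.Probability"
begin

text \<open>\<open>KL_divergence b M N\<close> is \<open>D(N \<parallel> M)\<close> (reversed argument order), and it is meaningful only if
  \<open>N\<close> is absolutely continuous with respect to \<open>M\<close>.\<close>

definition kl_div :: "'a::finite pmf \<Rightarrow> 'a pmf \<Rightarrow> ereal" where
  "kl_div Q P =
    (if set_pmf Q \<subseteq> set_pmf P
     then ereal (KL_divergence (exp 1) (measure_pmf P) (measure_pmf Q)) else \<infinity>)"

lemma kl_div_eq_sum:
  fixes P Q :: "'a::finite pmf"
  assumes "set_pmf Q \<subseteq> set_pmf P"
  shows "kl_div Q P = ereal (\<Sum>x\<in>UNIV. pmf Q x * ln (pmf Q x / pmf P x))"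
proof -
  interpret C: finite_measure "count_space (UNIV :: 'a set)"
    by (rule finite_measure_count_space) simp
  have 1: "measure_pmf R = density (count_space UNIV) (\<lambda>x. ennreal (pmf R x))" for R :: "'a pmf"
    by (rule measure_pmf_eq_density)
  have "KL_divergence (exp 1) (measure_pmf P) (measure_pmf Q) =
      (\<integral>x. pmf Q x * log (exp 1) (pmf Q x / pmf P x) \<partial>count_space UNIV)"
    unfolding 1 using assms
    by (intro C.KL_density_density) (auto simp: set_pmf_iff AE_count_space)
  then show ?thesis
    using assms by (simp add: kl_div_def lebesgue_integral_count_space_finite log_def)
qed

definition Rs_star :: "'a::finite pmf \<Rightarrow> 'a pmf \<Rightarrow> real \<Rightarrow> ereal" where
  "Rs_star P Q E0 = ereal E0 - kl_div Q P"

text \<open>The expectation is used only when \<open>Q\<close> is absolutely continuous with respect to \<open>P\<close>, where the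
  convention \<open>ln (1 / 0) = 0\<close> is harmless.\<close>

definition Rw_star :: "'a::finite pmf \<Rightarrow> 'a pmf \<Rightarrow> real \<Rightarrow> ereal" where
  "Rw_star P Q E0 =
    (if kl_div Q P < ereal E0
     then ereal (measure_pmf.expectation Q (\<lambda>x. ln (1 / pmf P x)) - E0) else \<infinity>)"

text \<open>Continuity is with respect to the Euclidean topology on probability vectors, that is, the
  topology induced on \<open>'a pmf\<close> by \<open>pmf\<close>. Rates are nonnegative because index sets of size
  \<open>exp (n * R)\<close> are nonempty for every \<open>n\<close>.\<close>

definition rate_function :: "('a::finite pmf \<Rightarrow> real) \<Rightarrow> bool" where
  "rate_function R \<longleftrightarrow>
    continuous_map (pullback_topology UNIV pmf euclidean) euclidean R \<and> (\<forall>Q. 0 \<le> R Q)"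

definition type_of_vec :: "'a list \<Rightarrow> 'a pmf" where
  "type_of_vec xs = pmf_of_multiset (mset xs)"

definition index_set :: "nat \<Rightarrow> real \<Rightarrow> nat set" where
  "index_set n R = {1..nat \<lceil>exp (real n * R)\<rceil>}"

text \<open>A code maps a source vector \<open>xs\<close> to the pair \<open>(g xs, f xs)\<close> of secret key and helper message.\<close>

type_synonym 'a bio_code = "'a list \<Rightarrow> nat \<times> nat"

text \<open>The value \<open>(1, 1)\<close> on vectors of other lengths is never used.\<close>

definition random_binning ::
    "('a::finite pmf \<Rightarrow> real) \<Rightarrow> ('a pmf \<Rightarrow> real) \<Rightarrow> nat \<Rightarrow> 'a bio_code pmf" where
  "random_binning Rs Rw n =
    Pi_pmf {xs. length xs = n} (1, 1)
      (\<lambda>xs. pair_pmf (pmf_of_set (index_set n (Rs (type_of_vec xs))))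
                     (pmf_of_set (index_set n (Rw (type_of_vec xs)))))"

text \<open>Sequences of codes, one for each block length, drawn independently.\<close>

definition random_binning_seq ::
    "('a::finite pmf \<Rightarrow> real) \<Rightarrow> ('a pmf \<Rightarrow> real) \<Rightarrow> (nat \<Rightarrow> 'a bio_code) measure" where
  "random_binning_seq Rs Rw = (\<Pi>\<^sub>M n\<in>UNIV. measure_pmf (random_binning Rs Rw n))"

definition map_guess :: "'a pmf \<Rightarrow> nat \<Rightarrow> 'a bio_code \<Rightarrow> nat \<Rightarrow> nat" where
  "map_guess P n c w =
    (ARG_MAX (\<lambda>s. \<P>(xs in measure_pmf (replicate_pmf n P). fst (c xs) = s \<bar> snd (c xs) = w)) s. True)"

definition fa_prob :: "'a pmf \<Rightarrow> nat \<Rightarrow> 'a bio_code \<Rightarrow> real" where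
  "fa_prob P n c =
    measure_pmf.prob (replicate_pmf n P) {xs. map_guess P n c (snd (c xs)) = fst (c xs)}"

definition decay_exponent :: "(nat \<Rightarrow> real) \<Rightarrow> ereal" where
  "decay_exponent p = liminf (\<lambda>n. ereal (- ln (p n) / real n))"

definition fa_exponent :: "'a pmf \<Rightarrow> (nat \<Rightarrow> 'a bio_code) \<Rightarrow> ereal" where
  "fa_exponent P c = decay_exponent (\<lambda>n. fa_prob P n (c n))"

definition mean_fa_exponent ::
    "'a::finite pmf \<Rightarrow> ('a pmf \<Rightarrow> real) \<Rightarrow> ('a pmf \<Rightarrow> real) \<Rightarrow> ereal" where
  "mean_fa_exponent P Rs Rw =
    decay_exponent (\<lambda>n. measure_pmf.expectation (random_binning Rs Rw n) (fa_prob P n))"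

text \<open>Existence of codes within the ensemble is existence with positive probability. Existence over
  all maps into the prescribed index sets would be a different property: if \<open>f\<close> is constant, the rate
  \<open>Rw\<close> is not used at all, and no upper bound on it is necessary.\<close>

definition random_binning_codes_achieve ::
    "'a::finite pmf \<Rightarrow> ('a pmf \<Rightarrow> real) \<Rightarrow> ('a pmf \<Rightarrow> real) \<Rightarrow> real \<Rightarrow> bool" where
  "random_binning_codes_achieve P Rs Rw E0 \<longleftrightarrow>
    0 < \<P>(c in random_binning_seq Rs Rw. ereal E0 \<le> fa_exponent P c)"

end

theory Submission
  imports Defs "HOL-Real_Asymp.Real_Asymp"
begin

text \<open>
  Fix a type \<open>T\<close>, let \<open>M\<close> be the number of vectors of type \<open>T\<close>, and let \<open>q\<close> be the probability of
  each of them under \<open>P\<close>. With \<open>S\<close> keys and \<open>W\<close> helper messages, the expected contribution of \<open>T\<close> to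
  the FA probability is, up to polynomial factors, \<open>q * min M (max (M / S) W)\<close>: the guess collects one
  bin per helper message, and a bin holds about \<open>M / (S * W)\<close> vectors, or boundedly many if that number
  is small. Since \<open>q * M\<close> has exponent \<open>D(T \<parallel> P)\<close> and \<open>q\<close> has exponent \<open>E\<^sub>T log (1 / P)\<close>, the two rate
  conditions say exactly that each of these contributions has exponent at least \<open>E0\<close>. As there are only
  polynomially many types, this settles the mean exponent, and Markov's inequality with
  Borel-Cantelli gives almost every sequence of codes.

  Conversely, a violation at \<open>Q\<close> persists at nearby types, and by the law of large numbers
  and pigeonhole some nearby type has at least inverse polynomial probability under \<open>Q\<close>. If \<open>Rs\<close> is too
  small, a constant guess already succeeds too often, for every code of the ensemble. If \<open>Rw\<close> is
  too large, then with probability at least \<open>1 / 4\<close> a constant fraction of \<open>min W M\<close> helper messages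
  occurs, and the guess is right for one vector per message. Codes of
  different lengths are independent, so almost surely this happens for infinitely many lengths.
\<close>

subsection \<open>Types\<close>

abbreviation vecs :: "nat \<Rightarrow> 'a list set" where
  "vecs n \<equiv> {xs. length xs = n}"

definition types :: "nat \<Rightarrow> 'a pmf set" where
  "types n = type_of_vec ` vecs n"

definition vecs_of_type :: "nat \<Rightarrow> 'a pmf \<Rightarrow> 'a list set" where
  "vecs_of_type n T = {xs. length xs = n \<and> type_of_vec xs = T}"

lemma finite_vecs [simp]: "finite (vecs n :: 'a::finite list set)"
  using finite_lists_length_eq[of "UNIV :: 'a set" n] by simp

lemma card_vecs: "card (vecs n :: 'a::finite list set) = CARD('a) ^ n"
  using card_lists_length_eq[of "UNIV :: 'a set" n] by simp

lemma finite_vecs_of_type [simp]: "finite (vecs_of_type n T :: 'a::finite list set)"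
  by (rule finite_subset[OF _ finite_vecs[of n]]) (auto simp: vecs_of_type_def)

lemma finite_types [simp]: "finite (types n :: 'a::finite pmf set)"
  by (simp add: types_def)

text \<open>A type is determined by its letter counts, each between 0 and \<open>n\<close>.
  Polynomial growth makes sums and pigeonhole over types free at the level of exponents.\<close>

lemma card_types_le: "card (types n :: 'a::finite pmf set) \<le> (n + 1) ^ CARD('a)"
proof -
  let ?M = "mset ` vecs n :: 'a multiset set"
  have "card (types n :: 'a pmf set) = card (pmf_of_multiset ` ?M)"
    by (simp add: types_def type_of_vec_def image_image)
  also have "\<dots> \<le> card ?M"
    by (intro card_image_le finite_imageI finite_vecs)
  also have "card ?M = card (count ` ?M)"
    by (intro card_image[symmetric]) (auto simp: inj_on_def count_inject)
  also have "\<dots> \<le> card (UNIV \<rightarrow>\<^sub>E {..n} :: ('a \<Rightarrow> nat) set)"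
    by (intro card_mono finite_PiE) (auto simp: count_le_size[of "mset _", simplified])
  also have "\<dots> = (n + 1) ^ CARD('a)"
    by (simp add: card_PiE)
  finally show ?thesis .
qed

text \<open>The empty vector has no empirical distribution, whence \<open>n > 0\<close> here and
  below.\<close>

lemma pmf_type_of_vec:
  assumes "length xs = n" "n > 0"
  shows "pmf (type_of_vec xs) x = real (count (mset xs) x) / real n"
  using assms by (auto simp: type_of_vec_def)

lemma set_pmf_type_of_vec:
  assumes "length xs = n" "n > 0"
  shows "set_pmf (type_of_vec xs) = set xs"
  using assms by (auto simp: type_of_vec_def)

lemma pmf_replicate_pmf:
  "pmf (replicate_pmf n P) xs = (if length xs = n then prod_list (map (pmf P) xs) else 0)"
proof (induction n arbitrary: xs)
  case 0
  then show ?case by (auto simp: pmf_return)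
next
  case (Suc n)
  have eq: "replicate_pmf (Suc n) P = map_pmf (\<lambda>(x, xs). x # xs) (pair_pmf P (replicate_pmf n P))"
    by (simp add: pair_pmf_def map_bind_pmf map_pmf_def bind_assoc_pmf bind_return_pmf)
  show ?case
  proof (cases xs)
    case Nil
    have "[] \<notin> set_pmf (replicate_pmf (Suc n) P)"
      by (simp only: set_replicate_pmf) auto
    then show ?thesis using Nil by (simp add: pmf_eq_0_set_pmf del: replicate_pmf.simps)
  next
    case (Cons y ys)
    have "pmf (replicate_pmf (Suc n) P) ((\<lambda>(x, xs). x # xs) (y, ys)) = pmf (pair_pmf P (replicate_pmf n P)) (y, ys)"
      unfolding eq by (rule pmf_map_inj') (auto simp: inj_on_def)
    then show ?thesis using Cons Suc.IH[of ys] by (simp add: pmf_pair del: replicate_pmf.simps)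
  qed
qed

text \<open>The common \<open>P\<close>-probability of the vectors of type \<open>T\<close>; it is meaningful only if \<open>T\<close> is
  absolutely continuous with respect to \<open>P\<close>, because \<open>ln 0 = 0\<close>.\<close>

definition vec_prob :: "nat \<Rightarrow> 'a::finite pmf \<Rightarrow> 'a pmf \<Rightarrow> real" where
  "vec_prob n P T = exp (real n * (\<Sum>x\<in>UNIV. pmf T x * ln (pmf P x)))"

text \<open>Grouping equal letters, the log-likelihood depends only on the counts
  \<open>n * pmf T x\<close>; absolute continuity keeps every factor positive.\<close>

lemma pmf_replicate_pmf_eq_vec_prob:
  fixes P :: "'a::finite pmf"
  assumes "xs \<in> vecs_of_type n T" "n > 0" "set_pmf T \<subseteq> set_pmf P"
  shows "pmf (replicate_pmf n P) xs = vec_prob n P T"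
proof -
  have xs: "length xs = n" "type_of_vec xs = T" using assms by (auto simp: vecs_of_type_def)
  have pos: "pmf P x > 0" if "x \<in> set xs" for x
    using that assms(2,3) xs set_pmf_type_of_vec[of xs n] by (auto simp: pmf_positive_iff)
  have "ln (prod_list (map (pmf P) xs)) = sum_list (map (\<lambda>x. ln (pmf P x)) xs) \<and> prod_list (map (pmf P) xs) > 0"
    using pos
  proof (induction xs)
    case (Cons y ys)
    have "pmf P y > 0" using Cons.prems by simp
    moreover have "ln (prod_list (map (pmf P) ys)) = sum_list (map (\<lambda>x. ln (pmf P x)) ys) \<and> prod_list (map (pmf P) ys) > 0"
      using Cons by simp
    ultimately show ?case by (simp add: ln_mult)
  qed simp
  moreover have "sum_list (map (\<lambda>x. ln (pmf P x)) xs) = (\<Sum>x\<in>UNIV. real (count (mset xs) x) * ln (pmf P x))"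
  proof (induction xs)
    case (Cons y ys)
    have "(\<Sum>x\<in>UNIV. real (count (mset (y # ys)) x) * ln (pmf P x)) =
      (\<Sum>x\<in>UNIV. (if x = y then ln (pmf P x) else 0) + real (count (mset ys) x) * ln (pmf P x))"
      by (intro sum.cong) (auto simp: algebra_simps)
    then show ?case using Cons by (simp add: sum.distrib)
  qed simp
  moreover have "\<dots> = real n * (\<Sum>x\<in>UNIV. pmf T x * ln (pmf P x))"
    using assms(2) xs by (auto simp: pmf_type_of_vec sum_distrib_left intro!: sum.cong)
  ultimately have "prod_list (map (pmf P) xs) = exp (real n * (\<Sum>x\<in>UNIV. pmf T x * ln (pmf P x)))"
    by (metis exp_ln)
  then show ?thesis using xs by (simp add: pmf_replicate_pmf vec_prob_def)
qed

lemma pmf_replicate_pmf_eq_0: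
  fixes P :: "'a::finite pmf"
  assumes "xs \<in> vecs_of_type n T" "n > 0" "\<not> set_pmf T \<subseteq> set_pmf P"
  shows "pmf (replicate_pmf n P) xs = 0"
  using assms set_pmf_type_of_vec[of xs n]
  by (auto simp: vecs_of_type_def pmf_eq_0_set_pmf set_replicate_pmf in_lists_conv_set)

abbreviation class_prob :: "nat \<Rightarrow> 'a pmf \<Rightarrow> 'a pmf \<Rightarrow> real" where
  "class_prob n P T \<equiv> measure_pmf.prob (replicate_pmf n P) (vecs_of_type n T)"

lemma measure_replicate_pmf_subset_class:
  fixes P :: "'a::finite pmf"
  assumes "A \<subseteq> vecs_of_type n T" "n > 0" "set_pmf T \<subseteq> set_pmf P"
  shows "measure_pmf.prob (replicate_pmf n P) A = real (card A) * vec_prob n P T"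
proof -
  have "finite A" using assms(1) finite_subset by fastforce
  then have "measure_pmf.prob (replicate_pmf n P) A = (\<Sum>x\<in>A. pmf (replicate_pmf n P) x)"
    by (simp add: measure_measure_pmf_finite)
  also have "\<dots> = (\<Sum>x\<in>A. vec_prob n P T)"
    using assms by (intro sum.cong pmf_replicate_pmf_eq_vec_prob) auto
  finally show ?thesis by simp
qed

lemma class_prob_eq_0:
  fixes P :: "'a::finite pmf"
  assumes "n > 0" "\<not> set_pmf T \<subseteq> set_pmf P"
  shows "class_prob n P T = 0"
  using assms by (simp add: measure_measure_pmf_finite pmf_replicate_pmf_eq_0)

text \<open>Both product measures are constant on a type class, so one exponential converts one into
  the other. For fixed \<open>Q\<close> the logarithms do not depend on \<open>T\<close>, so limits
  along types need no continuity of the divergence.\<close>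

lemma class_prob_change_of_measure:
  fixes P Q T :: "'a::finite pmf"
  assumes "n > 0" "set_pmf T \<subseteq> set_pmf Q" "set_pmf Q \<subseteq> set_pmf P"
  shows "class_prob n P T = class_prob n Q T * exp (- real n * (\<Sum>x\<in>UNIV. pmf T x * ln (pmf Q x / pmf P x)))"
proof -
  have "(\<Sum>x\<in>UNIV. pmf T x * ln (pmf Q x / pmf P x)) = (\<Sum>x\<in>UNIV. pmf T x * ln (pmf Q x) - pmf T x * ln (pmf P x))"
  proof (intro sum.cong refl)
    fix x
    show "pmf T x * ln (pmf Q x / pmf P x) = pmf T x * ln (pmf Q x) - pmf T x * ln (pmf P x)"
      using assms(2,3) by (cases "x \<in> set_pmf T")
        (auto simp: ln_div pmf_positive_iff algebra_simps set_pmf_iff subset_iff)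
  qed
  then have "vec_prob n P T = vec_prob n Q T * exp (- real n * (\<Sum>x\<in>UNIV. pmf T x * ln (pmf Q x / pmf P x)))"
    by (simp add: vec_prob_def exp_add[symmetric] sum_subtractf right_diff_distrib)
  then show ?thesis
    using assms measure_replicate_pmf_subset_class[OF order_refl, of n T P] measure_replicate_pmf_subset_class[OF order_refl, of n T Q]
    by simp
qed

lemma class_prob_le:
  fixes P :: "'a::finite pmf"
  assumes "n > 0" "set_pmf T \<subseteq> set_pmf P"
  shows "class_prob n P T \<le> exp (- real n * (\<Sum>x\<in>UNIV. pmf T x * ln (pmf T x / pmf P x)))"
proof -
  let ?D = "\<Sum>x\<in>UNIV. pmf T x * ln (pmf T x / pmf P x)"
  have "class_prob n P T = class_prob n T T * exp (- real n * ?D)"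
    using assms by (intro class_prob_change_of_measure) auto
  also have "\<dots> \<le> 1 * exp (- real n * ?D)"
    by (intro mult_right_mono) auto
  finally show ?thesis by simp
qed

subsection \<open>Optimality of the MAP guess\<close>

text \<open>The success probability of any guess splits over the helper messages, and for each
  message the MAP key maximizes the joint probability. Every lower bound on \<open>fa_prob\<close>
  below comes from an explicit choice of \<open>V\<close>.\<close>

lemma MAP_optimal:
  fixes P :: "'a::finite pmf"
  shows "measure_pmf.prob (replicate_pmf n P) {xs. V (snd (c xs)) = fst (c xs)} \<le> fa_prob P n c"
proof -
  let ?M = "replicate_pmf n P"
  let ?W = "snd ` c ` vecs n"
  have fin: "finite ?W" by simp
  have decomp: "measure_pmf.prob ?M {xs. U (snd (c xs)) = fst (c xs)} =
      (\<Sum>w\<in>?W. measure_pmf.prob ?M {xs. fst (c xs) = U w \<and> snd (c xs) = w})" for U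
  proof -
    have "measure_pmf.prob ?M {xs. U (snd (c xs)) = fst (c xs)} =
       measure_pmf.prob ?M (\<Union>w\<in>?W. {xs. fst (c xs) = U w \<and> snd (c xs) = w})"
    proof (rule measure_prob_cong_0)
      fix xs
      assume "xs \<in> {xs. U (snd (c xs)) = fst (c xs)} - (\<Union>w\<in>?W. {xs. fst (c xs) = U w \<and> snd (c xs) = w})"
      then have U: "U (snd (c xs)) = fst (c xs)" "\<not> (\<exists>w\<in>?W. fst (c xs) = U w \<and> snd (c xs) = w)"
        by (simp_all only: Diff_iff mem_Collect_eq UN_iff not_False_eq_True)
      have "xs \<notin> vecs n"
      proof
        assume "xs \<in> vecs n"
        then have "snd (c xs) \<in> ?W" by (intro imageI)
        with U show False by metis
      qed
      then show "pmf ?M xs = 0" by (simp add: pmf_replicate_pmf)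
    qed auto
    also have "\<dots> = (\<Sum>w\<in>?W. measure_pmf.prob ?M {xs. fst (c xs) = U w \<and> snd (c xs) = w})"
      by (rule measure_pmf.finite_measure_finite_Union[OF fin]) (auto simp: disjoint_family_on_def)
    finally show ?thesis .
  qed
  have opt: "measure_pmf.prob ?M {xs. fst (c xs) = s \<and> snd (c xs) = w} \<le>
     measure_pmf.prob ?M {xs. fst (c xs) = map_guess P n c w \<and> snd (c xs) = w}" for s w
  proof -
    let ?f = "\<lambda>s. \<P>(xs in measure_pmf ?M. fst (c xs) = s \<bar> snd (c xs) = w)"
    have f: "?f s = measure_pmf.prob ?M {xs. fst (c xs) = s \<and> snd (c xs) = w} / measure_pmf.prob ?M {xs. snd (c xs) = w}" for s
      by (simp add: cond_prob_def)
    \<comment> \<open>\<open>ARG_MAX\<close> is a choice and is a maximizer only if a maximum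
      exists. Finitely many keys occur and all others give 0, so it is attained.\<close>
    have "finite (range ?f)"
    proof (rule finite_subset)
      show "range ?f \<subseteq> insert 0 (?f ` fst ` c ` vecs n)"
      proof safe
        fix s assume "?f s \<notin> ?f ` fst ` c ` vecs n"
        then have "s \<notin> fst ` c ` vecs n" by (metis imageI)
        then have "measure_pmf.prob ?M {xs. fst (c xs) = s \<and> snd (c xs) = w} = 0"
          by (subst measure_pmf_zero_iff) (auto simp: set_replicate_pmf)
        then show "?f s = 0" by (simp only: f div_0)
      qed
    qed simp
    note fin_f = this
    have "Max (range ?f) \<in> range ?f" by (rule Max_in[OF fin_f]) simp
    then obtain s0 where "Max (range ?f) = ?f s0" by (rule rangeE)
    then have s0: "?f s \<le> ?f s0" for s
      using Max_ge[OF fin_f rangeI, of s] by (simp only:)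
    have "?f (map_guess P n c w) = ?f s0"
      unfolding map_guess_def by (rule arg_max_equality[where f = ?f and P = "\<lambda>_. True" and k = s0, OF TrueI s0])
    then have "?f s \<le> ?f (map_guess P n c w)"
      using s0 by (simp only:)
    then have le: "measure_pmf.prob ?M {xs. fst (c xs) = s \<and> snd (c xs) = w} / measure_pmf.prob ?M {xs. snd (c xs) = w} \<le>
        measure_pmf.prob ?M {xs. fst (c xs) = map_guess P n c w \<and> snd (c xs) = w} / measure_pmf.prob ?M {xs. snd (c xs) = w}"
      by (simp only: f)
    show ?thesis
    \<comment> \<open>For a message of probability 0 all conditional probabilities are 0 by the
      division convention and the guess is arbitrary, but the joint probabilities vanish
      too.\<close>
    proof (cases "measure_pmf.prob ?M {xs. snd (c xs) = w} = 0")
      case True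
      have "measure_pmf.prob ?M {xs. fst (c xs) = s \<and> snd (c xs) = w} \<le> measure_pmf.prob ?M {xs. snd (c xs) = w}"
        by (intro measure_pmf.finite_measure_mono) auto
      also have "\<dots> \<le> measure_pmf.prob ?M {xs. fst (c xs) = map_guess P n c w \<and> snd (c xs) = w}"
        using True by (simp only: measure_nonneg)
      finally show ?thesis .
    next
      case False
      then have "0 < measure_pmf.prob ?M {xs. snd (c xs) = w}"
        by (simp only: zero_less_measure_iff not_False_eq_True)
      with le show ?thesis by (simp only: divide_le_cancel)
    qed
  qed
  show ?thesis
    unfolding fa_prob_def decomp by (intro sum_mono opt)
qed

subsection \<open>Random binning of a type class\<close>

lemma finite_index_set [simp]: "finite (index_set n R)"
  by (simp add: index_set_def)

lemma index_set_nonempty [simp]: "index_set n R \<noteq> {}"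
proof -
  have "exp (real n * R) > 0" by simp
  then have "1 \<le> nat \<lceil>exp (real n * R)\<rceil>" by linarith
  then show ?thesis by (simp add: index_set_def)
qed

lemma card_index_set_pos: "real (card (index_set n R)) > 0"
  by (simp add: card_gt_0_iff)

lemma card_index_set_ge: "exp (real n * R) \<le> real (card (index_set n R))"
  by (simp add: index_set_def of_nat_ceiling)

text \<open>Since \<open>exp (n * R) \<ge> 1\<close>, rounding up costs at most a factor 2.\<close>

lemma card_index_set_le:
  assumes "R \<ge> 0"
  shows "real (card (index_set n R)) \<le> 2 * exp (real n * R)"
proof -
  have "real (card (index_set n R)) = of_int \<lceil>exp (real n * R)\<rceil>"
    using exp_gt_zero[of "real n * R"] by (simp add: index_set_def order.trans[OF _ le_of_int_ceiling])
  also have "\<dots> \<le> exp (real n * R) + 1" by linarith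
  also have "1 \<le> exp (real n * R)" using assms by simp
  finally show ?thesis by simp
qed

definition bin_pmf :: "('a pmf \<Rightarrow> real) \<Rightarrow> ('a pmf \<Rightarrow> real) \<Rightarrow> nat \<Rightarrow> 'a pmf \<Rightarrow> (nat \<times> nat) pmf" where
  "bin_pmf Rs Rw n T = pair_pmf (pmf_of_set (index_set n (Rs T))) (pmf_of_set (index_set n (Rw T)))"

lemma random_binning_eq:
  "random_binning Rs Rw n = Pi_pmf (vecs n) (1, 1) (\<lambda>xs. bin_pmf Rs Rw n (type_of_vec xs))"
  by (simp add: random_binning_def bin_pmf_def)

lemma set_bin_pmf: "set_pmf (bin_pmf Rs Rw n T) = index_set n (Rs T) \<times> index_set n (Rw T)"
  by (simp add: bin_pmf_def)

lemma finite_set_random_binning [simp]: "finite (set_pmf (random_binning Rs Rw n))"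
  by (auto simp: random_binning_eq set_Pi_pmf set_bin_pmf intro!: finite_PiE_dflt)

lemma random_binning_in_index_set:
  assumes "c \<in> set_pmf (random_binning Rs Rw n)" "xs \<in> vecs_of_type n T"
  shows "c xs \<in> index_set n (Rs T) \<times> index_set n (Rw T)"
  using assms
  by (auto simp: random_binning_eq set_Pi_pmf PiE_dflt_def set_bin_pmf vecs_of_type_def)

text \<open>The bins of different vectors are independent. Used with \<open>B = {b}\<close> for
  vectors sharing a bin, and with the complement of one message for a message missed by the whole
  class.\<close>

lemma prob_random_binning_all:
  assumes "A \<subseteq> vecs_of_type n T"
  shows "measure_pmf.prob (random_binning Rs Rw n) {c. \<forall>x\<in>A. c x \<in> B} =
    measure_pmf.prob (bin_pmf Rs Rw n T) B ^ card A"
proof -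
  have A: "A \<subseteq> vecs n" "\<And>x. x \<in> A \<Longrightarrow> type_of_vec x = T"
    using assms by (auto simp: vecs_of_type_def)
  have "{c. \<forall>x\<in>A. c x \<in> B} = Pi (vecs n) (\<lambda>x. if x \<in> A then B else UNIV)"
    using A(1) by (auto simp: Pi_def)
  then have "measure_pmf.prob (random_binning Rs Rw n) {c. \<forall>x\<in>A. c x \<in> B} =
    (\<Prod>x\<in>vecs n. measure_pmf.prob (bin_pmf Rs Rw n (type_of_vec x)) (if x \<in> A then B else UNIV))"
    by (simp add: random_binning_eq measure_Pi_pmf_Pi)
  also have "\<dots> = (\<Prod>x\<in>A. measure_pmf.prob (bin_pmf Rs Rw n (type_of_vec x)) (if x \<in> A then B else UNIV))"
    using A(1) by (intro prod.mono_neutral_right) auto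
  also have "\<dots> = (\<Prod>x\<in>A. measure_pmf.prob (bin_pmf Rs Rw n T) B)"
    using A(2) by (intro prod.cong) auto
  finally show ?thesis by simp
qed

section \<open>Moment bounds on the fullest bin\<close>

text \<open>From \<open>N = j\<close> on, each increment of \<open>N\<close> adds
  \<open>N choose j\<close>, at least 1, to the binomial coefficient. A bin load is thus bounded by
  a threshold plus a subset count, whose expectation is explicit.\<close>

lemma le_add_binomial: "N \<le> j + (N choose Suc j)"
proof (induction N)
  case (Suc N)
  show ?case
  proof (cases "N < j")
    case False
    then have "N choose j > 0" by (simp add: zero_less_binomial)
    then have "Suc (N choose Suc j) \<le> Suc N choose Suc j" by (simp add: Suc_le_eq)
    then show ?thesis using Suc.IH by linarith
  qed auto
qed simp

text \<open>The left side is one term of the exponential series. This is the elementary Stirling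
  bound \<open>(j / exp 1) ^ j \<le> fact j\<close>.\<close>

lemma power_div_fact_le:
  assumes "j > 0"
  shows "(real j ^ j) / fact j \<le> exp (real j)"
proof -
  have "(real j ^ j) / fact j = (\<Sum>i\<in>{j}. real j ^ i /\<^sub>R fact i)" by (simp add: field_simps)
  also have "\<dots> \<le> exp (real j)"
    unfolding exp_def by (rule sum_le_suminf) (use summable_exp_generic[of "real j"] in auto)
  finally show ?thesis .
qed

definition bin_count :: "nat \<Rightarrow> 'a pmf \<Rightarrow> 'a bio_code \<Rightarrow> nat \<times> nat \<Rightarrow> nat" where
  "bin_count n T c b = card {xs \<in> vecs_of_type n T. c xs = b}"

text \<open>The binomial coefficient counts the \<open>k\<close>-subsets of the class that lie
  entirely in bin \<open>b\<close>. Each does so with the \<open>k\<close>-th power of the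
  probability of \<open>b\<close>, and expectations add.\<close>

lemma expectation_choose_bin_count:
  fixes T :: "'a::finite pmf"
  assumes "b \<in> index_set n (Rs T) \<times> index_set n (Rw T)"
  shows "measure_pmf.expectation (random_binning Rs Rw n) (\<lambda>c. real (bin_count n T c b choose k)) =
    real (card (vecs_of_type n T) choose k) /
      (real (card (index_set n (Rs T))) * real (card (index_set n (Rw T)))) ^ k"
proof -
  let ?C = "vecs_of_type n T :: 'a list set"
  let ?F = "{A. A \<subseteq> ?C \<and> card A = k}"
  have fin: "finite ?F" by simp
  have "real (bin_count n T c b choose k) = (\<Sum>A\<in>?F. indicator {c. \<forall>x\<in>A. c x \<in> {b}} c)" for c
  proof -
    have "bin_count n T c b choose k = card {A. A \<subseteq> {xs \<in> ?C. c xs = b} \<and> card A = k}"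
      by (simp add: bin_count_def n_subsets)
    also have "{A. A \<subseteq> {xs \<in> ?C. c xs = b} \<and> card A = k} = {A\<in>?F. c \<in> {c. \<forall>x\<in>A. c x \<in> {b}}}"
      by auto
    finally show ?thesis
      using fin by (simp add: indicator_def sum.If_cases Int_def conj_assoc)
  qed
  then have "measure_pmf.expectation (random_binning Rs Rw n) (\<lambda>c. real (bin_count n T c b choose k)) =
    (\<Sum>A\<in>?F. measure_pmf.prob (random_binning Rs Rw n) {c. \<forall>x\<in>A. c x \<in> {b}})"
    by (simp add: Bochner_Integration.integral_sum integrable_measure_pmf_finite)
  also have "\<dots> = (\<Sum>A\<in>?F. measure_pmf.prob (bin_pmf Rs Rw n T) {b} ^ k)"
    by (intro sum.cong refl) (subst prob_random_binning_all[where T = T], auto)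
  also have "measure_pmf.prob (bin_pmf Rs Rw n T) {b} =
      1 / (real (card (index_set n (Rs T))) * real (card (index_set n (Rw T))))"
    using assms by (auto simp: measure_pmf_single bin_pmf_def pmf_pair)
  finally show ?thesis
    by (simp add: n_subsets power_divide)
qed

text \<open>With \<open>K\<close> bins for \<open>M\<close> vectors, at the threshold \<open>j = n * \<lceil>M / K\<rceil>\<close> the expected number of
  \<open>(j + 1)\<close>-subsets inside a common bin is at most \<open>1\<close>. By \<open>le_add_binomial\<close>, this controls the fullest
  key bin of all helper messages together.\<close>

lemma overload_bound:
  assumes "M \<le> d ^ n" "d > 0" "K > 0" "n \<ge> 3 * d" "j = n * nat \<lceil>real M / K\<rceil>"
  shows "K * (real (M choose Suc j) / K ^ Suc j) \<le> 1"
proof (cases "M = 0")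
  case False
  let ?a = "real M / K"
  have a: "?a > 0" using False assms(3) by simp
  then have ca: "\<lceil>?a\<rceil> \<ge> 1" by linarith
  then have nc: "nat \<lceil>?a\<rceil> \<ge> 1" by linarith
  have n: "n > 0" "3 \<le> n" using assms(2,4) by auto
  \<comment> \<open>The ceiling of a positive ratio is at least 1; this permits lowering the
    exponent from \<open>j\<close> to \<open>n\<close> below.\<close>
  have j: "j \<ge> n" using nc assms(5) by simp
  have "real (nat \<lceil>?a\<rceil>) \<ge> ?a" by (rule of_nat_ceiling)
  then have ja: "real n * ?a \<le> real j" unfolding assms(5) of_nat_mult by (intro mult_left_mono) auto
  have jpos: "j > 0" using j n by simp
  have "real ((M choose Suc j) * fact (Suc j)) \<le> real (M ^ Suc j)"
    by (rule of_nat_mono[OF binomial_fact_pow])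
  then have "real (M choose Suc j) \<le> real M ^ Suc j / fact (Suc j)"
    by (simp add: pos_le_divide_eq del: fact_Suc)
  \<comment> \<open>Giving up the factor \<open>Suc j\<close> leaves, after multiplication by
    \<open>K\<close>, one surplus factor \<open>M\<close> next to
    \<open>?a ^ j / fact j\<close>.\<close>
  also have "\<dots> \<le> real M ^ Suc j / fact j"
    by (intro divide_left_mono fact_mono) auto
  finally have "K * (real (M choose Suc j) / K ^ Suc j) \<le> K * ((real M ^ Suc j / fact j) / K ^ Suc j)"
    using assms(3) by (intro mult_left_mono divide_right_mono) auto
  also have "\<dots> = real M * (?a ^ j / fact j)"
    using assms(3) by (simp add: power_divide)
  also have "?a ^ j \<le> (real j / real n) ^ j"
    using ja n a by (intro power_mono) (auto simp: field_simps)
  then have "?a ^ j / fact j \<le> (real j / real n) ^ j / fact j"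
    by (intro divide_right_mono) auto
  also have "\<dots> = (real j ^ j / fact j) / real n ^ j"
    by (simp add: power_divide)
  also have "\<dots> \<le> exp (real j) / real n ^ j"
    by (intro divide_right_mono power_div_fact_le jpos) auto
  also have "\<dots> = (exp 1 / real n) ^ j"
    by (simp add: power_divide exp_of_nat_mult[symmetric])
  also have "\<dots> \<le> (exp 1 / real n) ^ n"
    using n j exp_le by (intro power_decreasing) (auto simp: field_simps)
  finally have "K * (real (M choose Suc j) / K ^ Suc j) \<le> real M * (exp 1 / real n) ^ n"
    by (simp add: mult_left_mono)
  also have "real M \<le> real (d ^ n)" using assms(1) by (rule of_nat_mono)
  also have "real (d ^ n) * (exp 1 / real n) ^ n = (real d * exp 1 / real n) ^ n"
    by (simp add: power_mult_distrib power_divide)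
  \<comment> \<open>The threshold \<open>3 * d\<close> on \<open>n\<close> is chosen for this step,
    as \<open>exp 1 \<le> 3\<close>.\<close>
  also have "\<dots> \<le> 1 ^ n"
  proof (intro power_mono)
    have "real d * exp 1 \<le> real d * 3" using exp_le by (intro mult_left_mono) auto
    also have "\<dots> \<le> real n" using assms(4) by linarith
    finally show "real d * exp 1 / real n \<le> 1" using n by simp
  qed auto
  finally show ?thesis by (simp add: mult_right_mono)
qed (use assms in auto)

text \<open>The guess \<open>V c\<close> may depend on the code, so only a bound uniform over all keys is usable here.\<close>

lemma expectation_hit_prob_le:
  fixes P T :: "'a::finite pmf"
  assumes "n \<ge> 3 * CARD('a)" "set_pmf T \<subseteq> set_pmf P"
  shows "measure_pmf.expectation (random_binning Rs Rw n)
      (\<lambda>c. measure_pmf.prob (replicate_pmf n P) {xs \<in> vecs_of_type n T. V c (snd (c xs)) = fst (c xs)}) \<le>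
    real n * class_prob n P T / real (card (index_set n (Rs T))) +
    (real n + 1) * real (card (index_set n (Rw T))) * vec_prob n P T"
    (is "measure_pmf.expectation ?B ?h \<le> _")
proof -
  let ?C = "vecs_of_type n T :: 'a list set"
  let ?S = "index_set n (Rs T)" and ?W = "index_set n (Rw T)"
  define M where "M = card ?C"
  define q where "q = vec_prob n P T"
  define K where "K = real (card ?S) * real (card ?W)"
  define j where "j = n * nat \<lceil>real M / K\<rceil>"
  have n: "n > 0" using assms(1) zero_less_card_finite[where 'a = 'a] by linarith
  have q: "q > 0" by (simp add: q_def vec_prob_def)
  have K: "K > 0" using card_index_set_pos by (simp add: K_def)
  have W: "real (card ?W) \<ge> 1" by (simp add: Suc_le_eq card_gt_0_iff)
  have S: "real (card ?S) > 0" by (rule card_index_set_pos)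
  have M: "M \<le> CARD('a) ^ n"
    unfolding M_def card_vecs[symmetric] by (intro card_mono) (auto simp: vecs_of_type_def)
  \<comment> \<open>Summing over all keys on the right removes the dependence on \<open>V c\<close>,
    so that expectations can be taken termwise.\<close>
  have pt: "?h c \<le> q * (real (card ?W) * real j + (\<Sum>b\<in>?S \<times> ?W. real (bin_count n T c b choose Suc j)))"
    if c: "c \<in> set_pmf ?B" for c
  proof -
    let ?A = "{xs \<in> ?C. V c (snd (c xs)) = fst (c xs)}"
    \<comment> \<open>One key bin per message counts; a guess outside \<open>?S\<close> is never
      right on this class.\<close>
    have "?A \<subseteq> (\<Union>w\<in>?W. if V c w \<in> ?S then {xs \<in> ?C. c xs = (V c w, w)} else {})"
      using random_binning_in_index_set[OF c] by (fastforce simp: mem_Times_iff prod_eq_iff)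
    then have "card ?A \<le> card (\<Union>w\<in>?W. if V c w \<in> ?S then {xs \<in> ?C. c xs = (V c w, w)} else {})"
      by (intro card_mono) auto
    also have "\<dots> \<le> (\<Sum>w\<in>?W. card (if V c w \<in> ?S then {xs \<in> ?C. c xs = (V c w, w)} else {}))"
      by (intro card_UN_le) auto
    also have "\<dots> \<le> (\<Sum>w\<in>?W. j + (\<Sum>s\<in>?S. bin_count n T c (s, w) choose Suc j))"
    proof (intro sum_mono)
      fix w
      show "card (if V c w \<in> ?S then {xs \<in> ?C. c xs = (V c w, w)} else {}) \<le>
        j + (\<Sum>s\<in>?S. bin_count n T c (s, w) choose Suc j)"
      proof (cases "V c w \<in> ?S")
        case True
        have "card {xs \<in> ?C. c xs = (V c w, w)} \<le> j + (bin_count n T c (V c w, w) choose Suc j)"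
          unfolding bin_count_def by (rule le_add_binomial)
        also have "bin_count n T c (V c w, w) choose Suc j \<le> (\<Sum>s\<in>?S. bin_count n T c (s, w) choose Suc j)"
          using True by (intro member_le_sum[where f = "\<lambda>s. bin_count n T c (s, w) choose Suc j"]) auto
        finally show ?thesis using True by simp
      qed auto
    qed
    also have "\<dots> = card ?W * j + (\<Sum>b\<in>?S \<times> ?W. bin_count n T c b choose Suc j)"
    proof -
      have "(\<Sum>w\<in>?W. \<Sum>s\<in>?S. bin_count n T c (s, w) choose Suc j) =
          (\<Sum>s\<in>?S. \<Sum>w\<in>?W. bin_count n T c (s, w) choose Suc j)"
        by (rule sum.swap)
      then show ?thesis by (simp add: sum.distrib sum.cartesian_product)
    qed
    finally have "real (card ?A) \<le> real (card ?W * j + (\<Sum>b\<in>?S \<times> ?W. bin_count n T c b choose Suc j))"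
      by (rule of_nat_mono)
    moreover have "?h c = real (card ?A) * q"
      unfolding q_def using assms n by (intro measure_replicate_pmf_subset_class) auto
    ultimately show ?thesis using q by (simp add: mult.commute)
  qed
  have int: "integrable ?B f" for f :: "'a bio_code \<Rightarrow> real"
    by (simp add: integrable_measure_pmf_finite)
  have "measure_pmf.expectation ?B ?h \<le> measure_pmf.expectation ?B
      (\<lambda>c. q * (real (card ?W) * real j + (\<Sum>b\<in>?S \<times> ?W. real (bin_count n T c b choose Suc j))))"
    by (intro integral_mono_AE int) (auto simp: AE_measure_pmf_iff pt)
  also have "\<dots> = q * (real (card ?W) * real j + (\<Sum>b\<in>?S \<times> ?W. 
      measure_pmf.expectation ?B (\<lambda>c. real (bin_count n T c b choose Suc j))))"
    by (simp add: Bochner_Integration.integral_add Bochner_Integration.integral_sum int)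
  also have "(\<Sum>b\<in>?S \<times> ?W. measure_pmf.expectation ?B (\<lambda>c. real (bin_count n T c b choose Suc j))) =
     (\<Sum>b\<in>?S \<times> ?W. real (M choose Suc j) / K ^ Suc j)"
    unfolding M_def K_def by (intro sum.cong refl expectation_choose_bin_count)
  also have "\<dots> = K * (real (M choose Suc j) / K ^ Suc j)"
    by (simp add: card_cartesian_product K_def)
  also have "\<dots> \<le> 1"
    using M K assms(1) by (intro overload_bound[where d = "CARD('a)" and n = n]) (auto simp: j_def)
  also have "real j \<le> real n * (real M / K + 1)"
  proof -
    have "real M / K \<ge> 0" using K by simp
    then have "real (nat \<lceil>real M / K\<rceil>) \<le> real M / K + 1" by linarith
    then show ?thesis unfolding j_def of_nat_mult by (intro mult_left_mono) auto
  qed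
  finally have "measure_pmf.expectation ?B ?h \<le>
     q * (real (card ?W) * (real n * (real M / K + 1)) + 1)"
    using q by (simp add: mult_left_mono)
  \<comment> \<open>The stray 1 is absorbed by \<open>card ?W \<ge> 1\<close>.\<close>
  also have "\<dots> \<le> q * (real (card ?W) * (real n * (real M / K + 1)) + real (card ?W))"
    using q W by (intro mult_left_mono add_left_mono) auto
  also have "\<dots> = real n * (real M * q) / real (card ?S) + (real n + 1) * real (card ?W) * q"
    using W S by (simp add: K_def field_simps)
  also have "real M * q = class_prob n P T"
    unfolding M_def q_def using assms n by (intro measure_replicate_pmf_subset_class[symmetric]) auto
  finally show ?thesis by (simp add: q_def)
qed

section \<open>Positivity and lower bounds for the FA probability of a code\<close>

lemma integrable_random_binning [simp]: "integrable (random_binning Rs Rw n) f"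
  for f :: "'a::finite bio_code \<Rightarrow> real"
  by (simp add: integrable_measure_pmf_finite)

text \<open>Each constant guess succeeds on all vectors with that key, and the keys in the index set
  cover the type class; averaging over them gives the bound.\<close>

lemma class_prob_le_fa_prob:
  fixes P :: "'a::finite pmf"
  assumes "c \<in> set_pmf (random_binning Rs Rw n)"
  shows "class_prob n P T / real (card (index_set n (Rs T))) \<le> fa_prob P n c"
proof -
  let ?S = "index_set n (Rs T)" and ?M = "replicate_pmf n P"
  have "class_prob n P T \<le> measure_pmf.prob ?M (\<Union>s\<in>?S. {xs. s = fst (c xs)})"
    using random_binning_in_index_set[OF assms, of _ T]
    by (intro measure_pmf.finite_measure_mono) (auto simp: mem_Times_iff)
  also have "\<dots> \<le> (\<Sum>s\<in>?S. measure_pmf.prob ?M {xs. s = fst (c xs)})"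
    by (intro measure_pmf.finite_measure_subadditive_finite) auto
  also have "\<dots> \<le> (\<Sum>s\<in>?S. fa_prob P n c)"
    by (intro sum_mono MAP_optimal[where V = "\<lambda>_. _", simplified])
  finally show ?thesis
    using card_index_set_pos[of n "Rs T"] by (simp add: field_simps)
qed

text \<open>Strict positivity matters because \<open>ln 0 = 0\<close> would turn a vanishing
  probability into exponent 0.\<close>

lemma fa_prob_pos:
  fixes P :: "'a::finite pmf"
  shows "fa_prob P n c > 0"
proof -
  obtain xs where xs: "xs \<in> set_pmf (replicate_pmf n P)"
    using set_pmf_not_empty[of "replicate_pmf n P"] by auto
  have "0 < measure_pmf.prob (replicate_pmf n P) {ys. fst (c xs) = fst (c ys)}"
    using xs by (intro measure_pmf_posI) auto
  also have "\<dots> \<le> fa_prob P n c"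
    by (rule MAP_optimal[where V = "\<lambda>_. _"])
  finally show ?thesis .
qed

lemma expectation_fa_prob_pos: "measure_pmf.expectation (random_binning Rs Rw n) (fa_prob P n) > 0"
  for P :: "'a::finite pmf"
proof -
  let ?B = "random_binning Rs Rw n"
  have "measure_pmf.expectation ?B (fa_prob P n) = (\<Sum>c\<in>set_pmf ?B. pmf ?B c * fa_prob P n c)"
    by (subst integral_measure_pmf_real[of "set_pmf ?B"]) (auto simp: mult.commute)
  also have "\<dots> > 0"
    using fa_prob_pos[of P n] by (intro sum_pos) (auto simp: pmf_positive set_pmf_not_empty)
  finally show ?thesis .
qed

subsection \<open>Sufficiency\<close>

definition admissible_rates :: "'a::finite pmf \<Rightarrow> ('a pmf \<Rightarrow> real) \<Rightarrow> ('a pmf \<Rightarrow> real) \<Rightarrow> real \<Rightarrow> bool" where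
  "admissible_rates P Rs Rw E0 \<longleftrightarrow>
    (\<forall>Q. ereal (Rs Q) \<ge> Rs_star P Q E0 \<and> ereal (Rw Q) \<le> Rw_star P Q E0)"

lemma Rs_star_eq:
  assumes "set_pmf Q \<subseteq> set_pmf P"
  shows "Rs_star P Q E0 = ereal (E0 - (\<Sum>x\<in>UNIV. pmf Q x * ln (pmf Q x / pmf P x)))"
  by (simp add: Rs_star_def kl_div_eq_sum assms)

lemma Rw_star_eq:
  assumes "set_pmf Q \<subseteq> set_pmf P"
  shows "Rw_star P Q E0 =
    (if (\<Sum>x\<in>UNIV. pmf Q x * ln (pmf Q x / pmf P x)) < E0
     then ereal (- (\<Sum>x\<in>UNIV. pmf Q x * ln (pmf P x)) - E0) else \<infinity>)"
proof -
  have "measure_pmf.expectation Q (\<lambda>x. ln (1 / pmf P x)) = (\<Sum>x\<in>UNIV. ln (1 / pmf P x) * pmf Q x)"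
    by (rule integral_measure_pmf_real) auto
  also have "\<dots> = - (\<Sum>x\<in>UNIV. pmf Q x * ln (pmf P x))"
    by (simp add: sum_negf[symmetric] ln_div mult.commute divide_inverse ln_inverse)
  finally show ?thesis by (simp add: Rw_star_def kl_div_eq_sum assms)
qed

text \<open>A type outside the support of \<open>P\<close> has no mass. For divergence at least
  \<open>E0\<close> the class probability alone is small enough, which is the infinite branch of
  \<open>Rw_star\<close>. Otherwise \<open>Rs\<close> controls the key term and \<open>Rw\<close>
  the message term, with prefactor \<open>n + 2 * (n + 1)\<close>.\<close>

lemma expectation_hit_prob_le_exponent:
  fixes P :: "'a::finite pmf"
  assumes adm: "admissible_rates P Rs Rw E0" and Rw: "\<And>Q. Rw Q \<ge> 0" and n: "n \<ge> 3 * CARD('a)"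
  shows "measure_pmf.expectation (random_binning Rs Rw n)
      (\<lambda>c. measure_pmf.prob (replicate_pmf n P) {xs \<in> vecs_of_type n T. V c (snd (c xs)) = fst (c xs)}) \<le>
    (3 * real n + 2) * exp (- real n * E0)"
    (is "measure_pmf.expectation ?B ?h \<le> _")
proof -
  let ?D = "\<Sum>x\<in>UNIV. pmf T x * ln (pmf T x / pmf P x)"
  let ?L = "\<Sum>x\<in>UNIV. pmf T x * ln (pmf P x)"
  have n0: "n > 0" using n zero_less_card_finite[where 'a = 'a] by linarith
  have le: "measure_pmf.expectation ?B ?h \<le> class_prob n P T"
  proof -
    have "measure_pmf.expectation ?B ?h \<le> measure_pmf.expectation ?B (\<lambda>_. class_prob n P T)"
      by (intro integral_mono measure_pmf.finite_measure_mono) auto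
    then show ?thesis by simp
  qed
  consider "\<not> set_pmf T \<subseteq> set_pmf P" | "set_pmf T \<subseteq> set_pmf P" "?D \<ge> E0" | "set_pmf T \<subseteq> set_pmf P" "?D < E0"
    by linarith
  then show ?thesis
  proof cases
    case 1
    then show ?thesis using le class_prob_eq_0[OF n0 1] by (simp add: order_trans)
  next
    case 2
    have "class_prob n P T \<le> exp (- real n * ?D)" by (rule class_prob_le[OF n0 2(1)])
    also have "\<dots> \<le> exp (- real n * E0)" using 2(2) by (simp add: mult_left_mono)
    also have "\<dots> \<le> (3 * real n + 2) * exp (- real n * E0)" by simp
    finally show ?thesis using le by linarith
  next
    case 3
    have Rs: "Rs T \<ge> E0 - ?D"
      using adm Rs_star_eq[OF 3(1), of E0] by (auto simp: admissible_rates_def dest: spec[of _ T])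
    have RwT: "Rw T \<le> - ?L - E0"
      using adm Rw_star_eq[OF 3(1), of E0] 3(2) by (auto simp: admissible_rates_def dest: spec[of _ T])
    have "measure_pmf.expectation ?B ?h \<le> real n * class_prob n P T / real (card (index_set n (Rs T))) +
      (real n + 1) * real (card (index_set n (Rw T))) * vec_prob n P T"
      by (rule expectation_hit_prob_le[OF n 3(1)])
    also have "real n * class_prob n P T / real (card (index_set n (Rs T))) \<le>
        real n * exp (- real n * ?D) / exp (real n * Rs T)"
      by (intro frac_le mult_left_mono class_prob_le[OF n0 3(1)] card_index_set_ge) auto
    also have "\<dots> = real n * exp (- real n * (?D + Rs T))"
      by (simp add: exp_diff[symmetric] exp_minus[symmetric] divide_inverse exp_add[symmetric] algebra_simps)
    also have "\<dots> \<le> real n * exp (- real n * E0)"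
      using Rs mult_left_mono[of E0 "?D + Rs T" "real n"] by (intro mult_left_mono) auto
    also have "(real n + 1) * real (card (index_set n (Rw T))) * vec_prob n P T \<le>
        (real n + 1) * (2 * exp (real n * Rw T)) * exp (real n * ?L)"
      unfolding vec_prob_def by (intro mult_right_mono mult_left_mono card_index_set_le Rw) auto
    also have "\<dots> = 2 * (real n + 1) * exp (real n * (Rw T + ?L))"
      by (simp add: distrib_left exp_add)
    also have "\<dots> \<le> 2 * (real n + 1) * exp (real n * (- E0))"
      using RwT mult_left_mono[of "Rw T + ?L" "- E0" "real n"] by (intro mult_left_mono) auto
    finally show ?thesis by (simp add: algebra_simps)
  qed
qed

text \<open>The first factor bounds the number of types over \<open>d\<close> letters, the second is
  the prefactor for one type.\<close>

definition fa_poly :: "nat \<Rightarrow> nat \<Rightarrow> real" where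
  "fa_poly d n = (real n + 1) ^ d * (3 * real n + 2)"

lemma expectation_fa_prob_le:
  fixes P :: "'a::finite pmf"
  assumes "admissible_rates P Rs Rw E0" "\<And>Q. Rw Q \<ge> 0" "n \<ge> 3 * CARD('a)"
  shows "measure_pmf.expectation (random_binning Rs Rw n) (fa_prob P n) \<le>
    fa_poly CARD('a) n * exp (- real n * E0)"
proof -
  let ?B = "random_binning Rs Rw n"
  let ?A = "\<lambda>c T. {xs \<in> vecs_of_type n T. map_guess P n c (snd (c xs)) = fst (c xs)}"
  have "fa_prob P n c = (\<Sum>T\<in>types n. measure_pmf.prob (replicate_pmf n P) (?A c T))" for c
  proof -
    have "fa_prob P n c = measure_pmf.prob (replicate_pmf n P) (\<Union>T\<in>types n. ?A c T)"
      unfolding fa_prob_def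
      by (rule measure_prob_cong_0) (auto simp: pmf_replicate_pmf types_def vecs_of_type_def)
    also have "\<dots> = (\<Sum>T\<in>types n. measure_pmf.prob (replicate_pmf n P) (?A c T))"
      by (rule measure_pmf.finite_measure_finite_Union)
        (auto simp: disjoint_family_on_def vecs_of_type_def)
    finally show ?thesis .
  qed
  then have "fa_prob P n = (\<lambda>c. \<Sum>T\<in>types n. measure_pmf.prob (replicate_pmf n P) (?A c T))"
    by (rule ext)
  then have "measure_pmf.expectation ?B (fa_prob P n) =
      (\<Sum>T\<in>types n. measure_pmf.expectation ?B (\<lambda>c. measure_pmf.prob (replicate_pmf n P) (?A c T)))"
    by (simp add: Bochner_Integration.integral_sum)
  also have "\<dots> \<le> (\<Sum>T\<in>(types n :: 'a pmf set). (3 * real n + 2) * exp (- real n * E0))"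
    by (intro sum_mono expectation_hit_prob_le_exponent assms)
  also have "\<dots> = real (card (types n :: 'a pmf set)) * ((3 * real n + 2) * exp (- real n * E0))"
    by simp
  also have "\<dots> \<le> real ((n + 1) ^ CARD('a)) * ((3 * real n + 2) * exp (- real n * E0))"
    by (intro mult_right_mono of_nat_mono card_types_le) auto
  finally show ?thesis by (simp add: fa_poly_def algebra_simps)
qed

text \<open>The prefactor \<open>r\<close> shifts the normalized logarithm by
  \<open>ln (r n) / n\<close>, which vanishes in the limit.\<close>

lemma decay_exponent_ge:
  assumes le: "\<forall>\<^sub>F n in sequentially. 0 < p n \<and> p n \<le> r n * exp (- real n * E)"
    and r: "(\<lambda>n. ln (r n) / real n) \<longlonglongrightarrow> 0"
  shows "ereal E \<le> decay_exponent p"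
proof -
  have lim: "(\<lambda>n. ereal (E - ln (r n) / real n)) \<longlonglongrightarrow> ereal (E - 0)"
    by (intro tendsto_intros r)
  have "ereal E = liminf (\<lambda>n. ereal (E - ln (r n) / real n))"
    using lim_imp_Liminf[OF _ lim] by simp
  also have "\<dots> \<le> liminf (\<lambda>n. ereal (- ln (p n) / real n))"
  proof (rule Liminf_mono)
    show "\<forall>\<^sub>F n in sequentially. ereal (E - ln (r n) / real n) \<le> ereal (- ln (p n) / real n)"
      using le eventually_gt_at_top[of 0]
    proof eventually_elim
      case (elim n)
      then have "r n > 0" by (smt (verit) exp_gt_zero mult_nonpos_nonneg)
      have "ln (p n) \<le> ln (r n * exp (- real n * E))" using elim by (intro ln_mono) auto
      also have "\<dots> = ln (r n) - real n * E" using \<open>r n > 0\<close> by (simp add: ln_mult)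
      finally have "(real n * E - ln (r n)) / real n \<le> - ln (p n) / real n"
        by (intro divide_right_mono) auto
      then show ?case using elim by (simp add: diff_divide_distrib)
    qed
  qed
  finally show ?thesis by (simp add: decay_exponent_def)
qed

lemma mean_fa_exponent_ge:
  fixes P :: "'a::finite pmf"
  assumes "admissible_rates P Rs Rw E0" "\<And>Q. Rw Q \<ge> 0"
  shows "ereal E0 \<le> mean_fa_exponent P Rs Rw"
  unfolding mean_fa_exponent_def
proof (rule decay_exponent_ge)
  show "\<forall>\<^sub>F n in sequentially. 0 < measure_pmf.expectation (random_binning Rs Rw n) (fa_prob P n) \<and>
      measure_pmf.expectation (random_binning Rs Rw n) (fa_prob P n) \<le> fa_poly CARD('a) n * exp (- real n * E0)"
    using eventually_ge_at_top[of "3 * CARD('a)"]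
    by eventually_elim (simp only: expectation_fa_prob_pos expectation_fa_prob_le[OF assms] simp_thms)
  show "(\<lambda>n. ln (fa_poly CARD('a) n) / real n) \<longlonglongrightarrow> 0"
    unfolding fa_poly_def by real_asymp
qed

section \<open>The product measure on sequences of codes\<close>

lemma space_random_binning_seq [simp]: "space (random_binning_seq Rs Rw) = UNIV"
  by (simp add: random_binning_seq_def space_PiM)

lemma prob_space_random_binning_seq: "prob_space (random_binning_seq Rs Rw)"
  unfolding random_binning_seq_def by (intro prob_space_PiM measure_pmf.prob_space_axioms)

text \<open>Each component space is discrete, so every function of a single component is
  measurable.\<close>

lemma measurable_random_binning_seq_component [measurable]:
  "(\<lambda>c. f (c n)) \<in> measurable (random_binning_seq Rs Rw) N" if "f \<in> UNIV \<rightarrow> space N"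
proof -
  have "f \<in> measurable (measure_pmf (random_binning Rs Rw n)) N"
    using that by simp
  then show ?thesis
    unfolding random_binning_seq_def
    by (rule measurable_compose[OF measurable_component_singleton, rotated]) simp
qed

lemma prob_random_binning_seq:
  assumes "finite J"
  shows "measure (random_binning_seq Rs Rw) {c. \<forall>n\<in>J. c n \<in> A n} =
    (\<Prod>n\<in>J. measure_pmf.prob (random_binning Rs Rw n) (A n))"
proof -
  interpret product_prob_space "\<lambda>n. measure_pmf (random_binning Rs Rw n)" UNIV
    by unfold_locales
  have "emeasure (random_binning_seq Rs Rw) {c. \<forall>n\<in>J. c n \<in> A n} =
    (\<Prod>n\<in>J. emeasure (measure_pmf (random_binning Rs Rw n)) (A n))"
    using emeasure_PiM_Collect[of J A] assms by (simp add: random_binning_seq_def space_PiM)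
  then have "measure (random_binning_seq Rs Rw) {c. \<forall>n\<in>J. c n \<in> A n} =
      enn2real (\<Prod>n\<in>J. emeasure (measure_pmf (random_binning Rs Rw n)) (A n))"
    by (simp only: measure_def)
  then show ?thesis
    by (simp add: measure_pmf.emeasure_eq_measure prod_ennreal prod_nonneg)
qed

text \<open>Needed because \<open>measure\<close> is 0 on nonmeasurable sets. The exponent is a
  liminf of functions of single components.\<close>

lemma sets_fa_exponent:
  fixes P :: "'a::finite pmf"
  shows "{c. ereal E0 \<le> fa_exponent P c} \<in> sets (random_binning_seq Rs Rw)"
proof -
  have [measurable]: "(\<lambda>c. fa_exponent P c) \<in> borel_measurable (random_binning_seq Rs Rw)"
    unfolding fa_exponent_def decay_exponent_def
    by (intro borel_measurable_liminf measurable_random_binning_seq_component) auto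
  have "{c \<in> space (random_binning_seq Rs Rw). ereal E0 \<le> fa_exponent P c} \<in> sets (random_binning_seq Rs Rw)"
    by measurable
  then show ?thesis by simp
qed

text \<open>Markov's inequality, multiplied out.\<close>

lemma prob_greater_le_expectation:
  fixes f :: "'b \<Rightarrow> real"
  assumes "integrable (measure_pmf p) f" "\<And>x. f x \<ge> 0"
  shows "b * measure_pmf.prob p {x. b < f x} \<le> measure_pmf.expectation p f"
proof -
  have "b * measure_pmf.prob p {x. b < f x} = measure_pmf.expectation p (\<lambda>x. b * indicator {x. b < f x} x)"
    by simp
  also have "\<dots> \<le> measure_pmf.expectation p f"
  proof (rule integral_mono[OF _ assms(1)])
    show "integrable (measure_pmf p) (\<lambda>x. b * indicator {x. b < f x} x)"
      by (intro integrable_mult_right measure_pmf.integrable_const_bound[where B = 1]) auto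
  qed (use assms(2) in \<open>auto simp: indicator_def\<close>)
  finally show ?thesis .
qed

lemma AE_fa_exponent_ge:
  fixes P :: "'a::finite pmf"
  assumes "admissible_rates P Rs Rw E0" "\<And>Q. Rw Q \<ge> 0"
  shows "AE c in random_binning_seq Rs Rw. ereal E0 \<le> fa_exponent P c"
proof -
  let ?M = "random_binning_seq Rs Rw"
  interpret prob_space ?M by (rule prob_space_random_binning_seq)
  \<comment> \<open>The factor \<open>n ^ 2\<close> beyond the bound on the mean turns Markov's
    inequality into the summable bound \<open>1 / n ^ 2\<close> and leaves the exponent
    unchanged.\<close>
  define r where "r n = real n ^ 2 * fa_poly CARD('a) n" for n
  define A where "A n = {c. fa_prob P n (c n) > r n * exp (- real n * E0)}" for n
  have "A n \<in> events" for n
  proof -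
    have [measurable]: "(\<lambda>c. fa_prob P n (c n)) \<in> borel_measurable ?M"
      by (rule measurable_random_binning_seq_component) simp
    have "{c \<in> space ?M. fa_prob P n (c n) > r n * exp (- real n * E0)} \<in> events"
      by measurable
    then show ?thesis by (simp add: A_def)
  qed
  moreover have "prob (A n) \<le> 1 / real n ^ 2" if n: "n \<ge> 3 * CARD('a)" for n
  proof -
    let ?B = "random_binning Rs Rw n" and ?a = "fa_poly CARD('a) n * exp (- real n * E0)"
    have n0: "n > 0" using n zero_less_card_finite[where 'a = 'a] by linarith
    have a: "?a > 0" by (simp add: fa_poly_def add_pos_nonneg)
    have "prob (A n) = measure_pmf.prob ?B {c. real n ^ 2 * ?a < fa_prob P n c}"
      using prob_random_binning_seq[of "{n}" Rs Rw "\<lambda>n. {c. real n ^ 2 * ?a < fa_prob P n c}"]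
      by (simp add: A_def r_def mult.assoc)
    also have "real n ^ 2 * ?a * \<dots> \<le> measure_pmf.expectation ?B (fa_prob P n)"
      using fa_prob_pos[of P n] by (intro prob_greater_le_expectation) (simp_all add: less_imp_le)
    also have "\<dots> \<le> ?a" by (rule expectation_fa_prob_le[OF assms n])
    finally have "?a * (real n ^ 2 * prob (A n)) \<le> ?a * 1" by (simp only: ac_simps mult_1_right)
    then have "real n ^ 2 * prob (A n) \<le> 1" by (simp only: mult_le_cancel_left_pos[OF a])
    then show ?thesis using n0 by (simp add: field_simps)
  qed
  then have "\<forall>\<^sub>F n in sequentially. norm (prob (A n)) \<le> 1 / real n ^ 2"
    by (intro eventually_sequentiallyI[of "3 * CARD('a)"]) simp
  then have "summable (\<lambda>n. prob (A n))"
    by (rule summable_comparison_test_ev) (use inverse_power_summable[of 2, where 'a = real] in \<open>simp add: inverse_eq_divide\<close>)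
  ultimately have "AE c in ?M. \<forall>\<^sub>F n in sequentially. c \<in> space ?M - A n"
    by (intro borel_cantelli_AE1) (auto simp: emeasure_eq_measure)
  then show ?thesis
  proof (rule AE_mp, intro AE_I2 impI)
    fix c assume "\<forall>\<^sub>F n in sequentially. c \<in> space ?M - A n"
    then have "\<forall>\<^sub>F n in sequentially. 0 < fa_prob P n (c n) \<and> fa_prob P n (c n) \<le> r n * exp (- real n * E0)"
      by eventually_elim (simp add: A_def fa_prob_pos not_less)
    moreover have "(\<lambda>n. ln (r n) / real n) \<longlonglongrightarrow> 0"
      unfolding r_def fa_poly_def by real_asymp
    ultimately show "ereal E0 \<le> fa_exponent P c"
      unfolding fa_exponent_def by (rule decay_exponent_ge)
  qed
qed

lemma random_binning_codes_achieveI: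
  fixes P :: "'a::finite pmf"
  assumes "admissible_rates P Rs Rw E0" "\<And>Q. Rw Q \<ge> 0"
  shows "random_binning_codes_achieve P Rs Rw E0"
proof -
  interpret prob_space "random_binning_seq Rs Rw" by (rule prob_space_random_binning_seq)
  have "prob {c. ereal E0 \<le> fa_exponent P c} = 1"
    using AE_fa_exponent_ge[OF assms] by (subst prob_eq_1) (auto simp: sets_fa_exponent)
  then show ?thesis by (simp add: random_binning_codes_achieve_def)
qed

subsection \<open>Necessity\<close>

lemma decay_exponent_geD:
  assumes "ereal E \<le> decay_exponent p" "E' < E"
  shows "\<forall>\<^sub>F n in sequentially. p n < exp (- real n * E')"
proof -
  have "ereal E' < liminf (\<lambda>n. ereal (- ln (p n) / real n))"
    using assms by (simp add: decay_exponent_def less_le_trans[of "ereal E'" "ereal E"])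
  then have "\<forall>\<^sub>F n in sequentially. ereal E' < ereal (- ln (p n) / real n)"
    by (rule less_LiminfD)
  then show ?thesis
    using eventually_gt_at_top[of 0]
  proof eventually_elim
    case (elim n)
    then have *: "ln (p n) < - real n * E'" by (simp add: field_simps)
    show ?case
    proof (cases "p n > 0")
      case True
      then show ?thesis using * by (metis exp_less_mono exp_ln)
    next
      case False
      then show ?thesis by (meson exp_gt_zero le_less_trans not_less)
    qed
  qed
qed

text \<open>Any gap between two exponents absorbs a constant and a polynomial factor; the converse
  uses this for the mass of a likely type class.\<close>

lemma eventually_exp_ge:
  assumes "E < E'" "c > 0"
  shows "\<forall>\<^sub>F n in sequentially. c / (real n + 1) ^ d * exp (- real n * E) \<ge> exp (- real n * E')"
proof -
  have "(\<lambda>n. (real n + 1) ^ d / exp (real n * (E' - E))) \<longlonglongrightarrow> 0"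
    using assms(1) by real_asymp
  then have "\<forall>\<^sub>F n in sequentially. (real n + 1) ^ d / exp (real n * (E' - E)) < c"
    using assms(2) by (rule order_tendstoD)
  then show ?thesis
  proof eventually_elim
    case (elim n)
    have "exp (- real n * E') = exp (- real n * E) / exp (real n * (E' - E))"
      by (simp add: exp_diff[symmetric] algebra_simps)
    also have "\<dots> = ((real n + 1) ^ d / exp (real n * (E' - E))) * (1 / (real n + 1) ^ d * exp (- real n * E))"
      by (simp add: add_nonneg_eq_0_iff)
    also have "\<dots> \<le> c * (1 / (real n + 1) ^ d * exp (- real n * E))"
      using elim by (intro mult_right_mono) auto
    finally show ?case by simp
  qed
qed

text \<open>By independence of the lengths, all codes from \<open>N\<close> on beat
  \<open>exp (- n * E)\<close> with probability at most \<open>(3 / 4) ^ k\<close> for every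
  \<open>k\<close>, hence 0. Sequences that achieve \<open>E0\<close> lie in the countable union of
  these null events. For the mean, the event of probability \<open>1 / 4\<close> alone contributes
  too much.\<close>

lemma not_achieved_if_large_fa_prob:
  fixes P :: "'a::finite pmf"
  assumes ev: "\<forall>\<^sub>F n in sequentially.
      measure_pmf.prob (random_binning Rs Rw n) {c. exp (- real n * E) \<le> fa_prob P n c} \<ge> 1 / 4"
    and "E < E0"
  shows "\<not> random_binning_codes_achieve P Rs Rw E0" and "\<not> ereal E0 \<le> mean_fa_exponent P Rs Rw"
proof -
  let ?M = "random_binning_seq Rs Rw"
  interpret prob_space ?M by (rule prob_space_random_binning_seq)
  define A where "A n = {c. fa_prob P n c < exp (- real n * E)}" for n
  obtain N0 where N0: "\<And>n. n \<ge> N0 \<Longrightarrow> measure_pmf.prob (random_binning Rs Rw n) (A n) \<le> 3 / 4"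
  proof -
    obtain N where N: "\<And>n. n \<ge> N \<Longrightarrow> measure_pmf.prob (random_binning Rs Rw n) {c. exp (- real n * E) \<le> fa_prob P n c} \<ge> 1 / 4"
      using ev by (auto simp: eventually_sequentially)
    have "measure_pmf.prob (random_binning Rs Rw n) (A n) \<le> 3 / 4" if "n \<ge> N" for n
    proof -
      have "A n = UNIV - {c. exp (- real n * E) \<le> fa_prob P n c}" by (auto simp: A_def)
      then show ?thesis using N[OF that] measure_pmf.prob_compl[of "{c. exp (- real n * E) \<le> fa_prob P n c}" "random_binning Rs Rw n"]
        by simp
    qed
    then show ?thesis by (rule that)
  qed
  have sets: "{c. \<forall>n\<in>J. c n \<in> A n} \<in> events" for J
  proof -
    have [measurable]: "(\<lambda>c. c n \<in> A n) \<in> measurable ?M (count_space UNIV)" for n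
      by (rule measurable_random_binning_seq_component[where f = "\<lambda>c. c \<in> A n"]) simp
    have "{c \<in> space ?M. \<forall>n\<in>J. c n \<in> A n} \<in> events" by measurable
    then show ?thesis by simp
  qed
  have null: "prob {c. \<forall>n\<in>{N..}. c n \<in> A n} = 0" if "N \<ge> N0" for N
  proof -
    have "prob {c. \<forall>n\<in>{N..}. c n \<in> A n} \<le> (3 / 4) ^ k" for k
    proof -
      have "prob {c. \<forall>n\<in>{N..}. c n \<in> A n} \<le> prob {c. \<forall>n\<in>{N..<N + k}. c n \<in> A n}"
        by (intro finite_measure_mono sets) auto
      also have "\<dots> = (\<Prod>n\<in>{N..<N + k}. measure_pmf.prob (random_binning Rs Rw n) (A n))"
        by (rule prob_random_binning_seq) simp
      also have "\<dots> \<le> (\<Prod>n\<in>{N..<N + k}. 3 / 4)"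
        using that by (intro prod_mono conjI measure_nonneg N0) auto
      finally show ?thesis by simp
    qed
    moreover have "(\<lambda>k. (3 / 4 :: real) ^ k) \<longlonglongrightarrow> 0" by (rule LIMSEQ_realpow_zero) auto
    ultimately have "prob {c. \<forall>n\<in>{N..}. c n \<in> A n} \<le> 0"
      by (intro LIMSEQ_le_const) auto
    then show ?thesis by (simp add: measure_le_0_iff)
  qed
  have "prob {c. ereal E0 \<le> fa_exponent P c} \<le> prob (\<Union>N\<in>{N0..}. {c. \<forall>n\<in>{N..}. c n \<in> A n})"
  proof (rule finite_measure_mono)
    show "{c. ereal E0 \<le> fa_exponent P c} \<subseteq> (\<Union>N\<in>{N0..}. {c. \<forall>n\<in>{N..}. c n \<in> A n})"
    proof safe
      fix c assume "ereal E0 \<le> fa_exponent P c"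
      then have "\<forall>\<^sub>F n in sequentially. fa_prob P n (c n) < exp (- real n * E)"
        unfolding fa_exponent_def using \<open>E < E0\<close> by (rule decay_exponent_geD)
      then obtain N where "\<forall>n\<ge>N. c n \<in> A n" by (auto simp: eventually_sequentially A_def)
      then show "c \<in> (\<Union>N\<in>{N0..}. {c. \<forall>n\<in>{N..}. c n \<in> A n})"
        by (intro UN_I[of "max N N0"]) auto
    qed
    show "(\<Union>N\<in>{N0..}. {c. \<forall>n\<in>{N..}. c n \<in> A n}) \<in> events"
      by (intro sets.countable_UN'' sets) auto
  qed
  also have "\<dots> = 0"
  proof -
    have "(\<Union>N\<in>{N0..}. {c. \<forall>n\<in>{N..}. c n \<in> A n}) \<in> null_sets ?M"
      using null by (intro null_sets_UN') (auto simp: null_sets_def sets emeasure_eq_measure)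
    then show ?thesis by (simp add: measure_eq_0_null_sets)
  qed
  finally show "\<not> random_binning_codes_achieve P Rs Rw E0"
    by (simp add: random_binning_codes_achieve_def)
  show "\<not> ereal E0 \<le> mean_fa_exponent P Rs Rw"
  proof
    assume "ereal E0 \<le> mean_fa_exponent P Rs Rw"
    \<comment> \<open>The intermediate \<open>E'\<close> serves twice: the liminf bound needs a
      level strictly below \<open>E0\<close>, and the factor \<open>1 / 4\<close> needs a gap above
      \<open>E\<close>.\<close>
    moreover obtain E' where E': "E < E'" "E' < E0" using dense[OF \<open>E < E0\<close>] by blast
    ultimately have 1: "\<forall>\<^sub>F n in sequentially. measure_pmf.expectation (random_binning Rs Rw n) (fa_prob P n) < exp (- real n * E')"
      unfolding mean_fa_exponent_def using decay_exponent_geD by blast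
    have 2: "\<forall>\<^sub>F n in sequentially. (1 / 4) / (real n + 1) ^ 0 * exp (- real n * E) \<ge> exp (- real n * E')"
      using E' by (intro eventually_exp_ge) auto
    have "\<forall>\<^sub>F n in sequentially. False"
      using 1 2 ev
    proof eventually_elim
      case (elim n)
      let ?B = "random_binning Rs Rw n" and ?G = "{c. exp (- real n * E) \<le> fa_prob P n c}"
      have "1 / 4 * exp (- real n * E) \<le> measure_pmf.prob ?B ?G * exp (- real n * E)"
        using elim(3) by (intro mult_right_mono) auto
      also have "\<dots> = measure_pmf.expectation ?B (\<lambda>c. indicator ?G c * exp (- real n * E))"
        by simp
      also have "\<dots> \<le> measure_pmf.expectation ?B (fa_prob P n)"
      proof (rule integral_mono[OF integrable_random_binning integrable_random_binning])
        fix c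
        show "indicator ?G c * exp (- real n * E) \<le> fa_prob P n c"
          using fa_prob_pos[of P n c] by (auto simp: indicator_def)
      qed
      finally show ?case using elim(1,2) by simp
    qed
    then show False by simp
  qed
qed

section \<open>Likely types near a fixed distribution\<close>

text \<open>Open sets of the pullback topology are preimages under \<open>pmf\<close> of open sets
  of functions, where convergence is componentwise.\<close>

lemma tendsto_rate_function:
  fixes R :: "'a::finite pmf \<Rightarrow> real"
  assumes R: "rate_function R" and T: "\<And>x. (\<lambda>n. pmf (T n) x) \<longlonglongrightarrow> pmf Q x"
  shows "(\<lambda>n. R (T n)) \<longlonglongrightarrow> R Q"
proof (rule topological_tendstoI)
  fix U :: "real set" assume U: "open U" "R Q \<in> U"
  have "openin (pullback_topology UNIV pmf euclidean) {Q. R Q \<in> U}"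
    using R U(1) by (auto simp: rate_function_def continuous_map_def topspace_pullback_topology)
  then obtain V where V: "open V" "\<And>Q'. R Q' \<in> U \<longleftrightarrow> pmf Q' \<in> V"
    by (auto simp: openin_pullback_topology set_eq_iff)
  have "limitin (product_topology (\<lambda>_. euclidean) UNIV) (\<lambda>n. pmf (T n)) (pmf Q) sequentially"
    using T by (simp add: limitin_componentwise)
  then have "(\<lambda>n. pmf (T n)) \<longlonglongrightarrow> pmf Q"
    by (simp add: euclidean_product_topology)
  then have "\<forall>\<^sub>F n in sequentially. pmf (T n) \<in> V"
    by (rule topological_tendstoD) (use V U in auto)
  then show "\<forall>\<^sub>F n in sequentially. R (T n) \<in> U" by (simp add: V)
qed

lemma map_replicate_pmf: "replicate_pmf n (map_pmf f p) = map_pmf (map f) (replicate_pmf n p)"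
  by (induction n) (simp_all add: map_pmf_def bind_assoc_pmf bind_return_pmf)

text \<open>Marking the letter \<open>x\<close> gives independent Bernoulli trials; the binomial law
  makes Hoeffding's inequality available.\<close>

lemma map_pmf_count_replicate:
  "map_pmf (\<lambda>xs. count (mset xs) x) (replicate_pmf n Q) = binomial_pmf n (pmf Q x)"
proof -
  have "map_pmf (\<lambda>y. y = x) Q = bernoulli_pmf (pmf Q x)"
  proof (rule pmf_eqI)
    fix b
    have "(\<lambda>y. y = x) -` {True} = {x}" "(\<lambda>y. y = x) -` {False} = UNIV - {x}" by auto
    then show "pmf (map_pmf (\<lambda>y. y = x) Q) b = pmf (bernoulli_pmf (pmf Q x)) b"
      using measure_pmf.prob_compl[of "{x}" Q]
      by (cases b) (simp_all add: pmf_map measure_pmf_single pmf_le_1)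
  qed
  then have "binomial_pmf n (pmf Q x) =
      map_pmf (length \<circ> filter id) (map_pmf (map (\<lambda>y. y = x)) (replicate_pmf n Q))"
    by (simp add: binomial_pmf_altdef pmf_le_1 map_replicate_pmf[symmetric])
  also have "\<dots> = map_pmf (\<lambda>xs. count (mset xs) x) (replicate_pmf n Q)"
    unfolding map_pmf_comp
  proof (rule map_pmf_cong[OF refl])
    fix xs show "(length \<circ> filter id) (map (\<lambda>y. y = x) xs) = count (mset xs) x"
      by (induction xs) auto
  qed
  finally show ?thesis by simp
qed

text \<open>Hoeffding's inequality and a union bound over letters put mass above
  \<open>1 / 2\<close> on the types near \<open>Q\<close>; as there are at most
  \<open>(n + 1) ^ CARD('a)\<close> of them, one gets its share.\<close>

lemma ex_likely_type:
  fixes Q :: "'a::finite pmf"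
  shows "\<forall>\<^sub>F n in sequentially. \<exists>T\<in>types n. class_prob n Q T \<ge> 1 / 2 / (real n + 1) ^ CARD('a) \<and>
    (\<forall>x. \<bar>pmf T x - pmf Q x\<bar> < real n powr (- 1 / 4))"
proof -
  \<comment> \<open>The radius \<open>n powr (- 1 / 4)\<close> tends to 0, while \<open>n\<close>
    times its square is \<open>sqrt n\<close>, so that the tails still vanish.\<close>
  have "(\<lambda>n. real CARD('a) * (2 * exp (- 2 * real n * (real n powr (- 1 / 4))\<^sup>2))) \<longlonglongrightarrow> 0"
    by real_asymp
  then have "\<forall>\<^sub>F n in sequentially. real CARD('a) * (2 * exp (- 2 * real n * (real n powr (- 1 / 4))\<^sup>2)) < 1 / 2"
    by (rule order_tendstoD) simp
  then show ?thesis
    using eventually_gt_at_top[of 0]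
  proof eventually_elim
    case (elim n)
    let ?e = "real n powr (- 1 / 4)"
    let ?M = "replicate_pmf n Q"
    let ?bad = "\<lambda>x. {xs. \<bar>real (count (mset xs) x) / real n - pmf Q x\<bar> \<ge> ?e}"
    define G where "G = {T \<in> types n. \<forall>x. \<bar>pmf T x - pmf Q x\<bar> < ?e}"
    have bad: "measure_pmf.prob ?M (?bad x) \<le> 2 * exp (- 2 * real n * ?e\<^sup>2)" for x
    proof -
      interpret binomial_distribution n "pmf Q x" by unfold_locales (simp add: pmf_le_1)
      have "measure_pmf.prob ?M (?bad x) = measure_pmf.prob (binomial_pmf n (pmf Q x)) {k. \<bar>real k / real n - pmf Q x\<bar> \<ge> ?e}"
        by (simp add: map_pmf_count_replicate[symmetric] vimage_def)
      also have "\<dots> \<le> 2 * exp (- 2 * real n * ?e\<^sup>2)"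
        using prob_abs_ge'[of ?e] elim(2) by simp
      finally show ?thesis .
    qed
    have "1 - measure_pmf.prob ?M (\<Union>T\<in>G. vecs_of_type n T) = measure_pmf.prob ?M (- (\<Union>T\<in>G. vecs_of_type n T))"
      using measure_pmf.prob_compl[of "\<Union>T\<in>G. vecs_of_type n T" ?M] by (simp add: Compl_eq_Diff_UNIV)
    also have "\<dots> = measure_pmf.prob ?M (- (\<Union>T\<in>G. vecs_of_type n T) \<inter> vecs n)"
      by (rule measure_prob_cong_0) (auto simp: pmf_replicate_pmf)
    also have "\<dots> \<le> measure_pmf.prob ?M (\<Union>x\<in>UNIV. ?bad x)"
    proof (intro measure_pmf.finite_measure_mono subsetI)
      fix xs assume xs: "xs \<in> - (\<Union>T\<in>G. vecs_of_type n T) \<inter> vecs n"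
      then have "type_of_vec xs \<notin> G" "length xs = n" by (auto simp: vecs_of_type_def)
      then obtain x where "\<not> \<bar>pmf (type_of_vec xs) x - pmf Q x\<bar> < ?e"
        by (auto simp: G_def types_def)
      then show "xs \<in> (\<Union>x\<in>UNIV. ?bad x)"
        using pmf_type_of_vec[OF \<open>length xs = n\<close> elim(2), of x] by (intro UN_I[of x]) auto
    qed auto
    also have "\<dots> \<le> (\<Sum>x\<in>UNIV. measure_pmf.prob ?M (?bad x))"
      by (intro measure_pmf.finite_measure_subadditive_finite) auto
    also have "\<dots> \<le> (\<Sum>x\<in>(UNIV :: 'a set). 2 * exp (- 2 * real n * ?e\<^sup>2))"
      by (intro sum_mono bad)
    also have "\<dots> < 1 / 2" using elim(1) by simp
    finally have "1 / 2 < measure_pmf.prob ?M (\<Union>T\<in>G. vecs_of_type n T)" by simp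
    also have "\<dots> \<le> (\<Sum>T\<in>G. class_prob n Q T)"
      by (intro measure_pmf.finite_measure_subadditive_finite) (auto simp: G_def)
    finally have half: "1 / 2 < (\<Sum>T\<in>G. class_prob n Q T)" .
    show ?case
    proof (rule ccontr)
      assume "\<not> ?case"
      then have small: "class_prob n Q T \<le> 1 / 2 / (real n + 1) ^ CARD('a)" if "T \<in> G" for T
        using that by (force simp: G_def not_le intro: less_imp_le)
      have "(\<Sum>T\<in>G. class_prob n Q T) \<le> (\<Sum>T\<in>G. 1 / 2 / (real n + 1) ^ CARD('a))"
        by (intro sum_mono small)
      also have "\<dots> = real (card G) * (1 / 2 / (real n + 1) ^ CARD('a))" by simp
      also have "\<dots> \<le> real ((n + 1) ^ CARD('a)) * (1 / 2 / (real n + 1) ^ CARD('a))"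
      proof (intro mult_right_mono of_nat_mono)
        have "card G \<le> card (types n :: 'a pmf set)" by (intro card_mono) (auto simp: G_def)
        then show "card G \<le> (n + 1) ^ CARD('a)" using card_types_le order_trans by blast
      qed auto
      also have "\<dots> = 1 / 2" by (simp add: add_nonneg_eq_0_iff add.commute)
      finally show False using half by simp
    qed
  qed
qed

text \<open>One likely type is chosen for each length. Positive mass of its class under
  \<open>Q\<close> forces its support into that of \<open>Q\<close>.\<close>

lemma ex_likely_types:
  fixes Q :: "'a::finite pmf"
  obtains T where "\<forall>\<^sub>F n in sequentially. set_pmf (T n) \<subseteq> set_pmf Q"
    "\<forall>\<^sub>F n in sequentially. class_prob n Q (T n) \<ge> 1 / 2 / (real n + 1) ^ CARD('a)"
    "\<And>x. (\<lambda>n. pmf (T n) x) \<longlonglongrightarrow> pmf Q x"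
proof -
  define T where "T n = (SOME T. class_prob n Q T \<ge> 1 / 2 / (real n + 1) ^ CARD('a) \<and>
    (\<forall>x. \<bar>pmf T x - pmf Q x\<bar> < real n powr (- 1 / 4)))" for n
  have ev: "\<forall>\<^sub>F n in sequentially. class_prob n Q (T n) \<ge> 1 / 2 / (real n + 1) ^ CARD('a) \<and>
    (\<forall>x. \<bar>pmf (T n) x - pmf Q x\<bar> < real n powr (- 1 / 4))"
    using ex_likely_type[of Q]
  proof eventually_elim
    case (elim n)
    then obtain T where "class_prob n Q T \<ge> 1 / 2 / (real n + 1) ^ CARD('a) \<and>
        (\<forall>x. \<bar>pmf T x - pmf Q x\<bar> < real n powr (- 1 / 4))"
      by blast
    then show ?case unfolding T_def by (rule someI)
  qed
  show ?thesis
  proof (rule that)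
    show "\<forall>\<^sub>F n in sequentially. class_prob n Q (T n) \<ge> 1 / 2 / (real n + 1) ^ CARD('a)"
      using ev by eventually_elim simp
    show "\<forall>\<^sub>F n in sequentially. set_pmf (T n) \<subseteq> set_pmf Q"
      using ev eventually_gt_at_top[of 0]
    proof eventually_elim
      case (elim n)
      have "class_prob n Q (T n) > 0"
        by (rule less_le_trans[OF _ conjunct1[OF elim(1)]]) (simp add: add_nonneg_pos)
      then show ?case using class_prob_eq_0[of n "T n" Q] elim(2) by fastforce
    qed
    fix x
    have "(\<lambda>n. real n powr (- 1 / 4)) \<longlonglongrightarrow> 0" by real_asymp
    moreover have "\<forall>\<^sub>F n in sequentially. norm (pmf (T n) x - pmf Q x) \<le> real n powr (- 1 / 4)"
      using ev by eventually_elim (simp add: less_imp_le)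
    ultimately have "(\<lambda>n. pmf (T n) x - pmf Q x) \<longlonglongrightarrow> 0"
      by (rule Lim_null_comparison[rotated])
    then show "(\<lambda>n. pmf (T n) x) \<longlonglongrightarrow> pmf Q x" by (simp add: LIM_zero_iff)
  qed
qed

section \<open>The number of helper messages that occur\<close>

text \<open>The right side is the expected number of occupied bins for \<open>M\<close> balls in
  \<open>K\<close> bins. Bernoulli's inequality for \<open>(1 + 1 / K) ^ M\<close> and
  \<open>(1 - ?p) * (1 + ?p) \<le> 1\<close> bound it below by
  \<open>K * M / (K + M)\<close>.\<close>

lemma hit_bins_lower_bound:
  fixes K :: real
  assumes "K \<ge> 1"
  shows "min K (real M) / 2 \<le> K * (1 - (1 - 1 / K) ^ M)"
proof -
  let ?p = "1 / K"
  have p: "0 < ?p" "?p \<le> 1" using assms by auto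
  have pos: "1 + real M * ?p > 0" using assms by (simp add: add_pos_nonneg)
  have "(1 - ?p) ^ M * (1 + real M * ?p) \<le> (1 - ?p) ^ M * (1 + ?p) ^ M"
  proof (rule mult_left_mono)
    have "- 1 \<le> ?p" using p(1) by linarith
    then show "1 + real M * ?p \<le> (1 + ?p) ^ M" by (rule Bernoulli_inequality)
  qed (use p in simp)
  also have "\<dots> = ((1 - ?p) * (1 + ?p)) ^ M" by (simp add: power_mult_distrib)
  also have "\<dots> \<le> 1"
  proof (rule power_le_one)
    show "0 \<le> (1 - ?p) * (1 + ?p)" using p by (intro mult_nonneg_nonneg) auto
    show "(1 - ?p) * (1 + ?p) \<le> 1" by (simp add: algebra_simps)
  qed
  finally have "(1 - ?p) ^ M \<le> 1 / (1 + real M * ?p)" using pos by (simp add: field_simps)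
  also have "\<dots> = K / (K + real M)" using assms by (simp add: field_simps)
  finally have "K * (1 - K / (K + real M)) \<le> K * (1 - (1 - ?p) ^ M)"
    using assms by (intro mult_left_mono) auto
  moreover have "K * (1 - K / (K + real M)) = K * real M / (K + real M)"
    using assms by (simp add: field_simps)
  moreover have "min K (real M) / 2 \<le> K * real M / (K + real M)"
  proof -
    have "min K (real M) * (K + real M) \<le> min K (real M) * (2 * max K (real M))"
      using assms by (intro mult_left_mono) auto
    also have "\<dots> = 2 * (K * real M)" by (simp add: min_def max_def)
    finally show ?thesis using assms by (simp add: field_simps)
  qed
  ultimately show ?thesis by linarith
qed

text \<open>The expectation of the number of messages is at least half of its maximal value, so it cannot be
  below a quarter of that value with high probability.\<close>

lemma prob_many_helper_messages:
  fixes T :: "'a::finite pmf"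
  shows "1 / 4 \<le> measure_pmf.prob (random_binning Rs Rw n)
    {c. min (real (card (index_set n (Rw T)))) (real (card (vecs_of_type n T))) / 4 \<le>
      real (card (snd ` c ` vecs_of_type n T))}"
proof -
  let ?B = "random_binning Rs Rw n" and ?C = "vecs_of_type n T" and ?W = "index_set n (Rw T)"
  let ?K = "real (card ?W)"
  define m where "m = min ?K (real (card ?C))"
  define Z where "Z c = real (card {w \<in> ?W. \<exists>x\<in>?C. snd (c x) = w})" for c :: "'a bio_code"
  have K: "?K \<ge> 1" by (simp add: Suc_le_eq card_gt_0_iff)
  have Z_le: "Z c \<le> real (card (snd ` c ` ?C))" for c
    unfolding Z_def by (intro of_nat_mono card_mono) auto
  have "card (snd ` c ` ?C) \<le> card ?C" for c :: "'a bio_code"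
    by (simp add: image_image card_image_le)
  then have "Z c \<le> real (card ?C)" for c
    using Z_le[of c] by (meson of_nat_le_iff order_trans)
  moreover have "Z c \<le> ?K" for c
    unfolding Z_def by (intro of_nat_mono card_mono) auto
  ultimately have Zm: "Z c \<le> m" for c by (simp add: m_def)
  have hit: "measure_pmf.prob ?B {c. \<exists>x\<in>?C. snd (c x) = w} = 1 - (1 - 1 / ?K) ^ card ?C" if "w \<in> ?W" for w
  proof -
    have eq: "{c. \<exists>x\<in>?C. snd (c x) = w} = UNIV - {c. \<forall>x\<in>?C. c x \<in> - (UNIV \<times> {w})}"
      by (auto simp: mem_Times_iff)
    have "measure_pmf.prob ?B {c. \<exists>x\<in>?C. snd (c x) = w} =
        1 - measure_pmf.prob ?B {c. \<forall>x\<in>?C. c x \<in> - (UNIV \<times> {w})}"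
      unfolding eq using measure_pmf.prob_compl[of "{c. \<forall>x\<in>?C. c x \<in> - (UNIV \<times> {w})}" ?B] by simp
    also have "measure_pmf.prob ?B {c. \<forall>x\<in>?C. c x \<in> - (UNIV \<times> {w})} =
        measure_pmf.prob (bin_pmf Rs Rw n T) (- (UNIV \<times> {w})) ^ card ?C"
      by (rule prob_random_binning_all) simp
    also have "measure_pmf.prob (bin_pmf Rs Rw n T) (- (UNIV \<times> {w})) =
        1 - measure_pmf.prob (bin_pmf Rs Rw n T) (UNIV \<times> {w})"
      using measure_pmf.prob_compl[of "UNIV \<times> {w}" "bin_pmf Rs Rw n T"] by (simp add: Compl_eq_Diff_UNIV)
    also have "measure_pmf.prob (bin_pmf Rs Rw n T) (UNIV \<times> {w}) = 1 / ?K"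
    proof -
      have "measure_pmf.prob (bin_pmf Rs Rw n T) (UNIV \<times> {w}) =
          measure_pmf.prob (map_pmf snd (bin_pmf Rs Rw n T)) {w}"
        by (simp add: vimage_def) (rule arg_cong[where f = "measure_pmf.prob _"], auto)
      also have "\<dots> = 1 / ?K"
        using that by (simp add: bin_pmf_def map_snd_pair_pmf measure_pmf_single)
      finally show ?thesis .
    qed
    finally show ?thesis .
  qed
  have Z_sum: "Z c = (\<Sum>w\<in>?W. indicator {c. \<exists>x\<in>?C. snd (c x) = w} c)" for c
    by (simp add: Z_def indicator_def sum.If_cases Int_def)
  have "m / 2 \<le> ?K * (1 - (1 - 1 / ?K) ^ card ?C)"
    unfolding m_def by (rule hit_bins_lower_bound[OF K])
  also have "\<dots> = (\<Sum>w\<in>?W. measure_pmf.prob ?B {c. \<exists>x\<in>?C. snd (c x) = w})"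
    by (simp add: hit)
  also have "\<dots> = measure_pmf.expectation ?B Z"
    unfolding Z_sum by (simp add: Bochner_Integration.integral_sum)
  \<comment> \<open>\<open>Z\<close> is at most \<open>m\<close> on the event and below
    \<open>m / 4\<close> off it; against a mean of at least \<open>m / 2\<close> this leaves
    \<open>m / 4\<close> for the event.\<close>
  also have "\<dots> \<le> measure_pmf.expectation ?B (\<lambda>c. m / 4 + m * indicator {c. m / 4 \<le> Z c} c)"
  proof (rule integral_mono[OF integrable_random_binning integrable_random_binning])
    fix c
    have "m \<ge> 0" by (simp add: m_def)
    then show "Z c \<le> m / 4 + m * indicator {c. m / 4 \<le> Z c} c"
      using Zm[of c] by (auto simp: indicator_def)
  qed
  also have "\<dots> = m / 4 + m * measure_pmf.prob ?B {c. m / 4 \<le> Z c}"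
    by (subst Bochner_Integration.integral_add) simp_all
  finally have le: "m * (1 / 4) \<le> m * measure_pmf.prob ?B {c. m / 4 \<le> Z c}" by simp
  have "1 / 4 \<le> measure_pmf.prob ?B {c. m / 4 \<le> Z c}"
  proof (cases "m = 0")
    case True
    then show ?thesis by (simp add: Z_def)
  next
    case False
    moreover have "m \<ge> 0" by (simp add: m_def)
    ultimately have "m > 0" by simp
    then show ?thesis using le by (simp only: mult_le_cancel_left_pos)
  qed
  also have "\<dots> \<le> measure_pmf.prob ?B {c. m / 4 \<le> real (card (snd ` c ` ?C))}"
    using Z_le by (intro measure_pmf.finite_measure_mono) (auto intro: order_trans)
  finally show ?thesis by (simp only: m_def)
qed

text \<open>Choose one vector of the class for each message that occurs, and guess the key of that
  representative. The representatives are distinct and all guessed correctly.\<close>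

lemma helper_messages_le_fa_prob:
  fixes P T :: "'a::finite pmf"
  assumes "n > 0" "set_pmf T \<subseteq> set_pmf P"
  shows "real (card (snd ` c ` vecs_of_type n T)) * vec_prob n P T \<le> fa_prob P n c"
proof -
  let ?C = "vecs_of_type n T" and ?M = "replicate_pmf n P"
  obtain r where r: "\<And>w. w \<in> snd ` c ` ?C \<Longrightarrow> r w \<in> ?C \<and> snd (c (r w)) = w"
  proof (rule that)
    fix w assume "w \<in> snd ` c ` ?C"
    then show "(SOME x. x \<in> ?C \<and> snd (c x) = w) \<in> ?C \<and> snd (c (SOME x. x \<in> ?C \<and> snd (c x) = w)) = w"
      by (intro someI_ex[where P = "\<lambda>x. x \<in> ?C \<and> snd (c x) = w"]) auto
  qed
  let ?A = "r ` snd ` c ` ?C"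
  have "inj_on r (snd ` c ` ?C)" using r by (metis inj_onI)
  then have "card ?A = card (snd ` c ` ?C)" by (rule card_image)
  moreover have "measure_pmf.prob ?M ?A = real (card ?A) * vec_prob n P T"
    using r assms by (intro measure_replicate_pmf_subset_class) auto
  moreover have "measure_pmf.prob ?M ?A \<le> measure_pmf.prob ?M {xs. fst (c (r (snd (c xs)))) = fst (c xs)}"
    using r by (intro measure_pmf.finite_measure_mono) auto
  moreover have "\<dots> \<le> fa_prob P n c"
    by (rule MAP_optimal[where V = "\<lambda>w. fst (c (r w))"])
  ultimately show ?thesis by simp
qed

section \<open>Consequences of a violated rate condition\<close>

lemma large_fa_prob_if_small_Rs:
  fixes P Q :: "'a::finite pmf"
  assumes "rate_function Rs" and supp: "set_pmf Q \<subseteq> set_pmf P"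
    and small: "(\<Sum>x\<in>UNIV. pmf Q x * ln (pmf Q x / pmf P x)) + Rs Q < E"
  shows "\<forall>\<^sub>F n in sequentially.
      measure_pmf.prob (random_binning Rs Rw n) {c. exp (- real n * E) \<le> fa_prob P n c} \<ge> 1 / 4"
proof -
  obtain T where T: "\<forall>\<^sub>F n in sequentially. set_pmf (T n) \<subseteq> set_pmf Q"
    "\<forall>\<^sub>F n in sequentially. class_prob n Q (T n) \<ge> 1 / 2 / (real n + 1) ^ CARD('a)"
    "\<And>x. (\<lambda>n. pmf (T n) x) \<longlonglongrightarrow> pmf Q x"
    using ex_likely_types[of Q] by blast
  \<comment> \<open>The logarithms use the limit \<open>Q\<close> instead of \<open>T n\<close>, so
    \<open>d n\<close> is linear in \<open>pmf (T n)\<close> and its limit is immediate.\<close>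
  define d where "d n = (\<Sum>x\<in>UNIV. pmf (T n) x * ln (pmf Q x / pmf P x))" for n
  obtain E' where E': "(\<Sum>x\<in>UNIV. pmf Q x * ln (pmf Q x / pmf P x)) + Rs Q < E'" "E' < E"
    using dense[OF small] by blast
  have "(\<lambda>n. d n + Rs (T n)) \<longlonglongrightarrow> (\<Sum>x\<in>UNIV. pmf Q x * ln (pmf Q x / pmf P x)) + Rs Q"
    unfolding d_def by (intro tendsto_intros T(3) tendsto_rate_function[OF assms(1)])
  then have "\<forall>\<^sub>F n in sequentially. d n + Rs (T n) < E'"
    using E'(1) by (rule order_tendstoD)
  moreover have "\<forall>\<^sub>F n in sequentially. (1 / 4) / (real n + 1) ^ CARD('a) * exp (- real n * E') \<ge> exp (- real n * E)"
    using E'(2) by (intro eventually_exp_ge) auto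
  ultimately show ?thesis
    using T(1,2) eventually_gt_at_top[of 0]
  proof eventually_elim
    case (elim n)
    let ?r = "(real n + 1) ^ CARD('a)"
    have Rs: "Rs (T n) \<ge> 0" using assms(1) by (simp add: rate_function_def)
    have "exp (- real n * E) \<le> (1 / 4) / ?r * exp (- real n * E')" by (rule elim(2))
    also have "\<dots> \<le> (1 / 4) / ?r * exp (- real n * (d n + Rs (T n)))"
      using elim(1) mult_left_mono[of "d n + Rs (T n)" E' "real n"] by (intro mult_left_mono) auto
    \<comment> \<open>The factor \<open>1 / 4\<close> splits into \<open>1 / 2\<close> for the class
      mass and \<open>1 / 2\<close> for the rounding of the index set.\<close>
    also have "\<dots> = (1 / 2 / ?r * exp (- real n * d n)) / (2 * exp (real n * Rs (T n)))"
      by (simp add: exp_diff exp_minus field_simps exp_add)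
    also have "\<dots> \<le> (class_prob n Q (T n) * exp (- real n * d n)) / real (card (index_set n (Rs (T n))))"
      using elim(4) by (intro frac_le mult_right_mono card_index_set_le Rs card_index_set_pos) auto
    also have "class_prob n Q (T n) * exp (- real n * d n) = class_prob n P (T n)"
      unfolding d_def using elim supp by (intro class_prob_change_of_measure[symmetric]) auto
    finally have "exp (- real n * E) \<le> class_prob n P (T n) / real (card (index_set n (Rs (T n))))" .
    then have "\<forall>c\<in>set_pmf (random_binning Rs Rw n). exp (- real n * E) \<le> fa_prob P n c"
      using class_prob_le_fa_prob[of _ Rs Rw n P "T n"] order_trans by blast
    then have "measure_pmf.prob (random_binning Rs Rw n) {c. exp (- real n * E) \<le> fa_prob P n c} = 1"
      by (subst measure_pmf.prob_eq_1) (auto simp: AE_measure_pmf_iff)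
    then show ?case by simp
  qed
qed

text \<open>The number of occurring messages is of order \<open>min ?K ?M\<close>. After
  multiplication by \<open>?q\<close>, the first member has exponent about
  \<open>- b n - Rw (T n)\<close> and the second is a class probability of exponent about
  \<open>d n\<close>; the two strict inequalities handle one member each.\<close>

lemma large_fa_prob_if_large_Rw:
  fixes P Q :: "'a::finite pmf"
  assumes "rate_function Rw" and supp: "set_pmf Q \<subseteq> set_pmf P"
    and D: "(\<Sum>x\<in>UNIV. pmf Q x * ln (pmf Q x / pmf P x)) < E"
    and large: "- (\<Sum>x\<in>UNIV. pmf Q x * ln (pmf P x)) - Rw Q < E"
  shows "\<forall>\<^sub>F n in sequentially.
      measure_pmf.prob (random_binning Rs Rw n) {c. exp (- real n * E) \<le> fa_prob P n c} \<ge> 1 / 4"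
proof -
  obtain T where T: "\<forall>\<^sub>F n in sequentially. set_pmf (T n) \<subseteq> set_pmf Q"
    "\<forall>\<^sub>F n in sequentially. class_prob n Q (T n) \<ge> 1 / 2 / (real n + 1) ^ CARD('a)"
    "\<And>x. (\<lambda>n. pmf (T n) x) \<longlonglongrightarrow> pmf Q x"
    using ex_likely_types[of Q] by blast
  define d where "d n = (\<Sum>x\<in>UNIV. pmf (T n) x * ln (pmf Q x / pmf P x))" for n
  define b where "b n = (\<Sum>x\<in>UNIV. pmf (T n) x * ln (pmf P x))" for n
  obtain E' where E': "max (\<Sum>x\<in>UNIV. pmf Q x * ln (pmf Q x / pmf P x))
      (- (\<Sum>x\<in>UNIV. pmf Q x * ln (pmf P x)) - Rw Q) < E'" "E' < E"
    using dense[of "max (\<Sum>x\<in>UNIV. pmf Q x * ln (pmf Q x / pmf P x))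
      (- (\<Sum>x\<in>UNIV. pmf Q x * ln (pmf P x)) - Rw Q)" E] D large by auto
  have "d \<longlonglongrightarrow> (\<Sum>x\<in>UNIV. pmf Q x * ln (pmf Q x / pmf P x))"
    unfolding d_def[abs_def] by (intro tendsto_intros T(3))
  then have "\<forall>\<^sub>F n in sequentially. d n < E'"
    by (rule order_tendstoD) (use E' in simp)
  moreover have "(\<lambda>n. - b n - Rw (T n)) \<longlonglongrightarrow> - (\<Sum>x\<in>UNIV. pmf Q x * ln (pmf P x)) - Rw Q"
    unfolding b_def by (intro tendsto_intros T(3) tendsto_rate_function[OF assms(1)])
  then have "\<forall>\<^sub>F n in sequentially. - b n - Rw (T n) < E'"
    by (rule order_tendstoD) (use E' in simp)
  \<comment> \<open>Here \<open>1 / 8\<close> is \<open>1 / 2\<close> from the class mass times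
    \<open>1 / 4\<close> from the fraction of messages that occur.\<close>
  moreover have "\<forall>\<^sub>F n in sequentially. (1 / 8) / (real n + 1) ^ CARD('a) * exp (- real n * E') \<ge> exp (- real n * E)"
    using E'(2) by (intro eventually_exp_ge) auto
  ultimately show ?thesis
    using T(1,2) eventually_gt_at_top[of 0]
  proof eventually_elim
    case (elim n)
    let ?r = "(real n + 1) ^ CARD('a)" and ?B = "random_binning Rs Rw n"
    let ?K = "real (card (index_set n (Rw (T n))))" and ?M = "real (card (vecs_of_type n (T n)))"
    let ?q = "vec_prob n P (T n)"
    have q: "?q > 0" by (simp add: vec_prob_def)
    have r: "?r \<ge> 1" by (intro one_le_power) simp
    have supp': "set_pmf (T n) \<subseteq> set_pmf P" using elim(4) supp by blast
    \<comment> \<open>The factor \<open>1 / 2 / ?r\<close> is given away so that both members of the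
      minimum get the same lower bound.\<close>
    have 1: "1 / 2 / ?r * exp (- real n * E') \<le> ?K * ?q"
    proof -
      have "1 / 2 / ?r * exp (- real n * E') \<le> 1 * exp (- real n * E')"
      proof (rule mult_right_mono)
        have "1 / 2 / R \<le> 1" if "R \<ge> 1" for R :: real using that by (simp add: field_simps)
        then show "1 / 2 / ?r \<le> 1" using r .
      qed simp
      also have "\<dots> \<le> exp (real n * (Rw (T n) + b n))"
        using elim(2) mult_left_mono[of "- E'" "Rw (T n) + b n" "real n"] by simp
      also have "\<dots> = exp (real n * Rw (T n)) * ?q"
        by (simp add: vec_prob_def b_def distrib_left exp_add)
      also have "\<dots> \<le> ?K * ?q"
        using q by (intro mult_right_mono card_index_set_ge) auto
      finally show ?thesis .
    qed
    have 2: "1 / 2 / ?r * exp (- real n * E') \<le> ?M * ?q"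
    proof -
      have "1 / 2 / ?r * exp (- real n * E') \<le> class_prob n Q (T n) * exp (- real n * d n)"
        using elim(1,5) mult_left_mono[of "d n" E' "real n"] by (intro mult_mono) auto
      also have "\<dots> = class_prob n P (T n)"
        unfolding d_def using elim supp by (intro class_prob_change_of_measure[symmetric]) auto
      also have "\<dots> = ?M * ?q"
        using elim supp' by (intro measure_replicate_pmf_subset_class) auto
      finally show ?thesis .
    qed
    have "exp (- real n * E) \<le> (1 / 2 / ?r * exp (- real n * E')) / 4" using elim(3) by simp
    also have "\<dots> \<le> min (?K * ?q) (?M * ?q) / 4" using 1 2 by (intro divide_right_mono) auto
    also have "\<dots> = (min ?K ?M / 4) * ?q" using q by (simp add: min_mult_distrib_right)
    finally have le: "exp (- real n * E) \<le> (min ?K ?M / 4) * ?q" .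
    have "1 / 4 \<le> measure_pmf.prob ?B {c. min ?K ?M / 4 \<le> real (card (snd ` c ` vecs_of_type n (T n)))}"
      by (rule prob_many_helper_messages)
    also have "\<dots> \<le> measure_pmf.prob ?B {c. exp (- real n * E) \<le> fa_prob P n c}"
    proof (intro measure_pmf.finite_measure_mono subsetI CollectI)
      fix c :: "'a bio_code"
      assume "c \<in> {c. min ?K ?M / 4 \<le> real (card (snd ` c ` vecs_of_type n (T n)))}"
      then have "(min ?K ?M / 4) * ?q \<le> real (card (snd ` c ` vecs_of_type n (T n))) * ?q"
        using q by (intro mult_right_mono) auto
      also have "\<dots> \<le> fa_prob P n c"
        by (rule helper_messages_le_fa_prob[OF elim(6) supp'])
      finally show "exp (- real n * E) \<le> fa_prob P n c" using le by linarith
    qed simp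
    finally show ?case .
  qed
qed

lemma large_fa_prob_if_not_admissible:
  fixes P :: "'a::finite pmf"
  assumes "rate_function Rs" "rate_function Rw" "\<not> admissible_rates P Rs Rw E0"
  obtains E where "E < E0" "\<forall>\<^sub>F n in sequentially.
      measure_pmf.prob (random_binning Rs Rw n) {c. exp (- real n * E) \<le> fa_prob P n c} \<ge> 1 / 4"
proof -
  obtain Q where Q: "\<not> (ereal (Rs Q) \<ge> Rs_star P Q E0 \<and> ereal (Rw Q) \<le> Rw_star P Q E0)"
    using assms(3) by (auto simp: admissible_rates_def)
  \<comment> \<open>Otherwise the divergence is infinite, so \<open>Rs_star\<close> is
    \<open>- \<infinity>\<close> and \<open>Rw_star\<close> is \<open>\<infinity>\<close>, and
    nothing is violated at \<open>Q\<close>.\<close>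
  have supp: "set_pmf Q \<subseteq> set_pmf P"
    using Q by (auto simp: Rs_star_def Rw_star_def kl_div_def split: if_splits)
  let ?D = "\<Sum>x\<in>UNIV. pmf Q x * ln (pmf Q x / pmf P x)"
  let ?L = "\<Sum>x\<in>UNIV. pmf Q x * ln (pmf P x)"
  \<comment> \<open>A violation by \<open>Rw\<close> entails \<open>?D < E0\<close>, since
    \<open>Rw_star\<close> is infinite otherwise; hence the maximum.\<close>
  have "?D + Rs Q < E0 \<or> max ?D (- ?L - Rw Q) < E0"
    using Q by (auto simp: Rs_star_eq[OF supp] Rw_star_eq[OF supp] not_le split: if_splits)
  then show ?thesis
  proof
    assume "?D + Rs Q < E0"
    then obtain E where "?D + Rs Q < E" "E < E0" using dense by blast
    then show ?thesis using that large_fa_prob_if_small_Rs[OF assms(1) supp] by blast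
  next
    assume "max ?D (- ?L - Rw Q) < E0"
    then obtain E where "max ?D (- ?L - Rw Q) < E" "E < E0" using dense by blast
    then show ?thesis using that large_fa_prob_if_large_Rw[OF assms(2) supp] by auto
  qed
qed

theorem lemma2:
  fixes P :: "'a::finite pmf" and Rs Rw :: "'a pmf \<Rightarrow> real" and E0 :: real
  assumes "E0 > 0" and "rate_function Rs" and "rate_function Rw"
  shows "(random_binning_codes_achieve P Rs Rw E0 \<longleftrightarrow>
           (\<forall>Q. ereal (Rs Q) \<ge> Rs_star P Q E0 \<and> ereal (Rw Q) \<le> Rw_star P Q E0))
       \<and> (mean_fa_exponent P Rs Rw \<ge> ereal E0 \<longleftrightarrow>
           (\<forall>Q. ereal (Rs Q) \<ge> Rs_star P Q E0 \<and> ereal (Rw Q) \<le> Rw_star P Q E0))"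
  unfolding admissible_rates_def[symmetric]
proof (cases "admissible_rates P Rs Rw E0")
  case True
  then have "random_binning_codes_achieve P Rs Rw E0" "ereal E0 \<le> mean_fa_exponent P Rs Rw"
    using assms(3) by (auto simp: rate_function_def intro: random_binning_codes_achieveI mean_fa_exponent_ge)
  with True show "(random_binning_codes_achieve P Rs Rw E0 \<longleftrightarrow> admissible_rates P Rs Rw E0) \<and>
      (mean_fa_exponent P Rs Rw \<ge> ereal E0 \<longleftrightarrow> admissible_rates P Rs Rw E0)"
    by blast
next
  case False
  then obtain E where "E < E0" "\<forall>\<^sub>F n in sequentially.
      measure_pmf.prob (random_binning Rs Rw n) {c. exp (- real n * E) \<le> fa_prob P n c} \<ge> 1 / 4"
    using large_fa_prob_if_not_admissible[OF assms(2,3)] by blast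
  with False show "(random_binning_codes_achieve P Rs Rw E0 \<longleftrightarrow> admissible_rates P Rs Rw E0) \<and>
      (mean_fa_exponent P Rs Rw \<ge> ereal E0 \<longleftrightarrow> admissible_rates P Rs Rw E0)"
    using not_achieved_if_large_fa_prob by blast
qed

end
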